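(* Let $\Xi=(\Xi(t))_{t\ge0}$ be a stationary continuous-time $\mathbb{R}^d$-valued process, with rescaled integrals \[ \bar S_N(t)=\frac{1}{N^{1/2}}\int_0^{Nt}\Xi(s)\,\mathrm{d}s \] and iterated integrals $\bar{\mathbb{S}}_N(t)=\int_0^t\bar S_N(s)\otimes\mathrm{d}\bar S_N(s)$ (in the sense of Riemann--Stieltjes). Assume that the iterated invariance principle holds for $(\bar S_N,\bar{\mathbb{S}}_N)$ with a Brownian rough path limit $(\bar B,\bar{\mathbb{B}})$ with characteristics $(\bar\Sigma,\bar\Gamma)$. Assume that $\int_0^\infty\bar\Delta(s)\,\mathrm{d}s$ is well-defined and finite, where $\bar\Delta(s):=\mathbf{E}(\Xi(0)\otimes\Xi(s))$. Then necessarily \[ \bar\Sigma=2\,\mathrm{Sym}\Big(\int_0^\infty\bar\Delta(s)\,\mathrm{d}s\Big),\qquad \bar\Gamma=\int_0^\infty\bar\Delta(s)\,\mathrm{d}s. \] As a consequence, one has the area correction \[ \bar{\mathbb{B}}(1)=\int_0^1\bar B\otimes\circ\,\mathrm{d}\bar B+\mathrm{Anti}\Big(\int_0^\infty\bar\Delta(s)\,\mathrm{d}s\Big), \] where the stochastic integral is in the sense of Stratonovich.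
   Context: Conventions: $(x\otimes y)^{i,j}=x^iy^j$ for $x,y\in\mathbb{R}^d$; $(\mathbb{R}^d)^{\otimes 2}$ is identified with $d\times d$ matrices; expectations of random vectors and matrices are taken component-wise; $\mathrm{Sym}(M)=\frac12(M+M^T)$ and $\mathrm{Anti}(M)=\frac12(M-M^T)$ are the symmetric and antisymmetric parts of $M$. Brownian rough path: a Brownian rough path over $\mathbb{R}^d$ with characteristics $(\Sigma,\Gamma)\in(\mathbb{R}^d)^{\otimes2}\times(\mathbb{R}^d)^{\otimes2}$ is any process $t\mapsto(B(t),\mathbb{B}(t))$, where $B$ is a $d$-dimensional Brownian motion with covariance $\Sigma=\mathbf{E}(B(1)\otimes B(1))$ and $\mathbb{B}(t)=\int_0^tB\otimes\mathrm{d}B+t\Gamma$, i.e. $\mathbb{B}^{i,j}(t)=\int_0^tB^i(s)\,\mathrm{d}B^j(s)+t\,\Gamma^{i,j}$, with the integral in the sense of Itô. In particular $\Gamma=\mathbf{E}(\mathbb{B}(1))$. Iterated invariance principle: let $t\mapsto(S_N(t),\mathbb{S}_N(t))$, $N\ge1$, be random processes on $\mathbb{R}^d\times(\mathbb{R}^d)^{\otimes2}$. The iterated invariance principle holds for $(S_N,\mathbb{S}_N)$ with Brownian rough path limit $(B,\mathbb{B})$ if (1) for all $t$, the sequence $(S_N(t),\mathbb{S}_N(t))$ converges in law to $(B(t),\mathbb{B}(t))$ as $N\to\infty$; and (2) $\mathbf{E}(S_N(1)\otimes S_N(1))\to\mathbf{E}(B(1)\otimes B(1))$ and $\mathbf{E}(\mathbb{S}_N(1))\to\mathbf{E}(\mathbb{B}(1))$.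 *)

theory Defs
  imports "HOL-Probability.Probability"
begin

definition tensor :: "real ^ 'd \<Rightarrow> real ^ 'd \<Rightarrow> real ^ 'd ^ 'd"  (infixr "\<otimes>\<^sub>t" 75)
  where "x \<otimes>\<^sub>t y = (\<chi> i j. x $ i * y $ j)"

definition sym_part :: "real ^ 'd ^ 'd \<Rightarrow> real ^ 'd ^ 'd"
  where "sym_part A = (1 / 2) *\<^sub>R (A + transpose A)"

definition anti_part :: "real ^ 'd ^ 'd \<Rightarrow> real ^ 'd ^ 'd"
  where "anti_part A = (1 / 2) *\<^sub>R (A - transpose A)"

text \<open>\<open>\<tau> 0, \<dots>, \<tau> n\<close> are the points of a partition of \<open>[a, b]\<close>; values of \<open>\<tau>\<close> beyond \<open>n\<close> are irrelevant.\<close>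

definition is_partition :: "real \<Rightarrow> real \<Rightarrow> nat \<Rightarrow> (nat \<Rightarrow> real) \<Rightarrow> bool"
  where "is_partition a b n \<tau> \<longleftrightarrow> \<tau> 0 = a \<and> \<tau> n = b \<and> (\<forall>k<n. \<tau> k \<le> \<tau> (Suc k))"

definition has_rs_integral :: "(real \<Rightarrow> real) \<Rightarrow> (real \<Rightarrow> real) \<Rightarrow> real \<Rightarrow> real \<Rightarrow> real \<Rightarrow> bool"
  where "has_rs_integral f g a b I \<longleftrightarrow>
    (\<forall>\<epsilon>>0. \<exists>\<delta>>0. \<forall>n \<tau> \<xi>.
       is_partition a b n \<tau> \<and> (\<forall>k<n. \<tau> (Suc k) - \<tau> k < \<delta> \<and> \<xi> k \<in> {\<tau> k..\<tau> (Suc k)}) \<longrightarrow>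
       \<bar>(\<Sum>k<n. f (\<xi> k) * (g (\<tau> (Suc k)) - g (\<tau> k))) - I\<bar> < \<epsilon>)"

definition rs_integral :: "(real \<Rightarrow> real) \<Rightarrow> (real \<Rightarrow> real) \<Rightarrow> real \<Rightarrow> real \<Rightarrow> real"
  where "rs_integral f g a b = (THE I. has_rs_integral f g a b I)"

definition iterated_rs_integral :: "(real \<Rightarrow> real ^ 'd) \<Rightarrow> real \<Rightarrow> real ^ 'd ^ 'd"
  where "iterated_rs_integral x t = (\<chi> i j. rs_integral (\<lambda>s. x s $ i) (\<lambda>s. x s $ j) 0 t)"

definition measurable_process :: "'w measure \<Rightarrow> (real \<Rightarrow> 'w \<Rightarrow> 'a::topological_space) \<Rightarrow> bool"
  where "measurable_process M X \<longleftrightarrow>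
    (\<lambda>(t, \<omega>). X t \<omega>) \<in> borel_measurable (restrict_space borel {0..} \<Otimes>\<^sub>M M)"

definition stationary_process :: "'w measure \<Rightarrow> (real \<Rightarrow> 'w \<Rightarrow> 'a::topological_space) \<Rightarrow> bool"
  where "stationary_process M X \<longleftrightarrow>
    (\<forall>h\<ge>0. \<forall>J. finite J \<and> J \<subseteq> {0..} \<longrightarrow>
       distr M (PiM J (\<lambda>_. borel)) (\<lambda>\<omega>. \<lambda>s\<in>J. X (s + h) \<omega>) =
       distr M (PiM J (\<lambda>_. borel)) (\<lambda>\<omega>. \<lambda>s\<in>J. X s \<omega>))"

definition rescaled_integral :: "(real \<Rightarrow> 'w \<Rightarrow> real ^ 'd) \<Rightarrow> nat \<Rightarrow> real \<Rightarrow> 'w \<Rightarrow> real ^ 'd"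
  where "rescaled_integral \<Xi> N t \<omega> =
    (1 / sqrt (real N)) *\<^sub>R (LINT s:{0..real N * t}|lborel. \<Xi> s \<omega>)"

definition rescaled_iterated_integral ::
    "(real \<Rightarrow> 'w \<Rightarrow> real ^ 'd) \<Rightarrow> nat \<Rightarrow> real \<Rightarrow> 'w \<Rightarrow> real ^ 'd ^ 'd"
  where "rescaled_iterated_integral \<Xi> N t \<omega> =
    iterated_rs_integral (\<lambda>s. rescaled_integral \<Xi> N s \<omega>) t"

text \<open>The Bochner integral of a matrix-valued function is the matrix of the integrals of its entries.\<close>

definition autocorrelation :: "'w measure \<Rightarrow> (real \<Rightarrow> 'w \<Rightarrow> real ^ 'd) \<Rightarrow> real \<Rightarrow> real ^ 'd ^ 'd"
  where "autocorrelation M \<Xi> s = (\<integral>\<omega>. \<Xi> 0 \<omega> \<otimes>\<^sub>t \<Xi> s \<omega> \<partial>M)"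

text \<open>The case of variance \<open>0\<close> is a point mass and has to be separated, because it has no density.\<close>

definition centered_gaussian_vector :: "'w measure \<Rightarrow> ('w \<Rightarrow> real ^ 'd) \<Rightarrow> real ^ 'd ^ 'd \<Rightarrow> bool"
  where "centered_gaussian_vector M X C \<longleftrightarrow>
    X \<in> borel_measurable M \<and> transpose C = C \<and> (\<forall>u. 0 \<le> u \<bullet> (C *v u)) \<and>
    (\<forall>u. if u \<bullet> (C *v u) = 0 then AE \<omega> in M. u \<bullet> X \<omega> = 0
         else distributed M lborel (\<lambda>\<omega>. u \<bullet> X \<omega>) (normal_density 0 (sqrt (u \<bullet> (C *v u)))))"

definition natural_filtration ::
    "'w measure \<Rightarrow> (real \<Rightarrow> 'w \<Rightarrow> 'a::topological_space) \<Rightarrow> real \<Rightarrow> 'w measure"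
  where "natural_filtration M X t =
    sigma (space M) {X s -` A \<inter> space M |s A. 0 \<le> s \<and> s \<le> t \<and> A \<in> sets borel}"

definition brownian_motion :: "'w measure \<Rightarrow> (real \<Rightarrow> 'w \<Rightarrow> real ^ 'd) \<Rightarrow> real ^ 'd ^ 'd \<Rightarrow> bool"
  where "brownian_motion M B \<Sigma> \<longleftrightarrow>
    prob_space M \<and>
    (\<forall>t\<ge>0. B t \<in> borel_measurable M) \<and>
    (AE \<omega> in M. B 0 \<omega> = 0) \<and>
    (AE \<omega> in M. continuous_on {0..} (\<lambda>t. B t \<omega>)) \<and>
    (\<forall>s t. 0 \<le> s \<and> s \<le> t \<longrightarrow>
       centered_gaussian_vector M (\<lambda>\<omega>. B t \<omega> - B s \<omega>) ((t - s) *\<^sub>R \<Sigma>) \<and>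
       prob_space.indep_set M (sets (natural_filtration M B s))
         (sets (vimage_algebra (space M) (\<lambda>\<omega>. B t \<omega> - B s \<omega>) borel)))"

text \<open>
  The elementary integrand given by \<open>n, \<tau>, H\<close> is \<open>\<Sum>k<n. H k \<cdot> 1_(\<tau> k, \<tau> (k+1)]\<close> with \<open>H k\<close> bounded
  and known at time \<open>\<tau> k\<close>. Ito integrals over \<open>[0, T]\<close> are defined as limits in \<open>L\<^sup>2\<close> of integrals of
  elementary integrands that converge to the integrand in \<open>L\<^sup>2\<close> of the product measure. They are
  determined only up to null sets, hence they are given as a relation: \<open>I\<close> is a version of the integral.
\<close>

definition elementary_integrand ::
    "'w measure \<Rightarrow> (real \<Rightarrow> 'w measure) \<Rightarrow> real \<Rightarrow> nat \<Rightarrow> (nat \<Rightarrow> real) \<Rightarrow> (nat \<Rightarrow> 'w \<Rightarrow> real) \<Rightarrow> bool"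
  where "elementary_integrand M F T n \<tau> H \<longleftrightarrow>
    is_partition 0 T n \<tau> \<and>
    (\<forall>k<n. H k \<in> borel_measurable (F (\<tau> k)) \<and> bounded (H k ` space M))"

definition elementary_process ::
    "nat \<Rightarrow> (nat \<Rightarrow> real) \<Rightarrow> (nat \<Rightarrow> 'w \<Rightarrow> real) \<Rightarrow> real \<Rightarrow> 'w \<Rightarrow> real"
  where "elementary_process n \<tau> H s \<omega> = (\<Sum>k<n. H k \<omega> * indicator {\<tau> k<..\<tau> (Suc k)} s)"

definition elementary_integral ::
    "nat \<Rightarrow> (nat \<Rightarrow> real) \<Rightarrow> (nat \<Rightarrow> 'w \<Rightarrow> real) \<Rightarrow> (real \<Rightarrow> 'w \<Rightarrow> real) \<Rightarrow> 'w \<Rightarrow> real"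
  where "elementary_integral n \<tau> H W \<omega> = (\<Sum>k<n. H k \<omega> * (W (\<tau> (Suc k)) \<omega> - W (\<tau> k) \<omega>))"

definition is_ito_integral ::
    "'w measure \<Rightarrow> (real \<Rightarrow> 'w measure) \<Rightarrow> (real \<Rightarrow> 'w \<Rightarrow> real) \<Rightarrow> (real \<Rightarrow> 'w \<Rightarrow> real) \<Rightarrow> real \<Rightarrow>
     ('w \<Rightarrow> real) \<Rightarrow> bool"
  where "is_ito_integral M F X W T I \<longleftrightarrow>
    I \<in> borel_measurable M \<and>
    (\<exists>n \<tau> H.
       (\<forall>m. elementary_integrand M F T (n m) (\<tau> m) (H m)) \<and>
       (\<lambda>m. \<integral>\<^sup>+\<omega>. (\<integral>\<^sup>+s\<in>{0..T}.
              ennreal ((elementary_process (n m) (\<tau> m) (H m) s \<omega> - X s \<omega>)\<^sup>2) \<partial>lborel) \<partial>M)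
         \<longlonglongrightarrow> 0 \<and>
       (\<lambda>m. \<integral>\<^sup>+\<omega>. ennreal ((elementary_integral (n m) (\<tau> m) (H m) W \<omega> - I \<omega>)\<^sup>2) \<partial>M)
         \<longlonglongrightarrow> 0)"

text \<open>Limit in probability of the sums of products of increments, as the mesh tends to \<open>0\<close>.\<close>

definition is_covariation ::
    "'w measure \<Rightarrow> (real \<Rightarrow> 'w \<Rightarrow> real) \<Rightarrow> (real \<Rightarrow> 'w \<Rightarrow> real) \<Rightarrow> real \<Rightarrow> ('w \<Rightarrow> real) \<Rightarrow> bool"
  where "is_covariation M X Y T Q \<longleftrightarrow>
    Q \<in> borel_measurable M \<and>
    (\<forall>\<epsilon>>0. \<exists>\<delta>>0. \<forall>n \<tau>.
       is_partition 0 T n \<tau> \<and> (\<forall>k<n. \<tau> (Suc k) - \<tau> k < \<delta>) \<longrightarrow>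
       measure M {\<omega> \<in> space M.
         \<bar>(\<Sum>k<n. (X (\<tau> (Suc k)) \<omega> - X (\<tau> k) \<omega>) * (Y (\<tau> (Suc k)) \<omega> - Y (\<tau> k) \<omega>)) - Q \<omega>\<bar> > \<epsilon>} < \<epsilon>)"

text \<open>\<open>\<integral>X \<circ> dW = \<integral>X dW + [X, W] / 2\<close>.\<close>

definition is_stratonovich_integral ::
    "'w measure \<Rightarrow> (real \<Rightarrow> 'w measure) \<Rightarrow> (real \<Rightarrow> 'w \<Rightarrow> real) \<Rightarrow> (real \<Rightarrow> 'w \<Rightarrow> real) \<Rightarrow> real \<Rightarrow>
     ('w \<Rightarrow> real) \<Rightarrow> bool"
  where "is_stratonovich_integral M F X W T J \<longleftrightarrow>
    J \<in> borel_measurable M \<and>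
    (\<exists>I Q. is_ito_integral M F X W T I \<and> is_covariation M X W T Q \<and>
       (AE \<omega> in M. J \<omega> = I \<omega> + Q \<omega> / 2))"

definition is_iterated_ito_integral ::
    "'w measure \<Rightarrow> (real \<Rightarrow> 'w \<Rightarrow> real ^ 'd) \<Rightarrow> real \<Rightarrow> ('w \<Rightarrow> real ^ 'd ^ 'd) \<Rightarrow> bool"
  where "is_iterated_ito_integral M B T I \<longleftrightarrow>
    (\<forall>i j. is_ito_integral M (natural_filtration M B)
       (\<lambda>t \<omega>. B t \<omega> $ i) (\<lambda>t \<omega>. B t \<omega> $ j) T (\<lambda>\<omega>. I \<omega> $ i $ j))"

definition is_iterated_stratonovich_integral ::
    "'w measure \<Rightarrow> (real \<Rightarrow> 'w \<Rightarrow> real ^ 'd) \<Rightarrow> real \<Rightarrow> ('w \<Rightarrow> real ^ 'd ^ 'd) \<Rightarrow> bool"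
  where "is_iterated_stratonovich_integral M B T J \<longleftrightarrow>
    (\<forall>i j. is_stratonovich_integral M (natural_filtration M B)
       (\<lambda>t \<omega>. B t \<omega> $ i) (\<lambda>t \<omega>. B t \<omega> $ j) T (\<lambda>\<omega>. J \<omega> $ i $ j))"

definition brownian_rough_path ::
    "'w measure \<Rightarrow> (real \<Rightarrow> 'w \<Rightarrow> real ^ 'd) \<Rightarrow> (real \<Rightarrow> 'w \<Rightarrow> real ^ 'd ^ 'd) \<Rightarrow>
     real ^ 'd ^ 'd \<Rightarrow> real ^ 'd ^ 'd \<Rightarrow> bool"
  where "brownian_rough_path M B BB \<Sigma> \<Gamma> \<longleftrightarrow>
    brownian_motion M B \<Sigma> \<and>
    (\<forall>t\<ge>0. is_iterated_ito_integral M B t (\<lambda>\<omega>. BB t \<omega> - t *\<^sub>R \<Gamma>))"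

text \<open>
  The library's weak convergence is restricted to measures on the real line. The random variables
  may live on different probability spaces.
\<close>

definition converges_in_law ::
    "'v measure \<Rightarrow> (nat \<Rightarrow> 'v \<Rightarrow> 'a::topological_space) \<Rightarrow> 'w measure \<Rightarrow> ('w \<Rightarrow> 'a) \<Rightarrow> bool"
  where "converges_in_law M X M' Y \<longleftrightarrow>
    (\<forall>f :: 'a \<Rightarrow> real. continuous_on UNIV f \<and> bounded (range f) \<longrightarrow>
       (\<lambda>N. \<integral>\<omega>. f (X N \<omega>) \<partial>M) \<longlonglongrightarrow> (\<integral>\<omega>. f (Y \<omega>) \<partial>M'))"

text \<open>
  Measurability and integrability are stated explicitly because the Bochner integral of a
  non-integrable function is \<open>0\<close> by convention.
\<close>

definition iterated_invariance_principle ::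
    "'v measure \<Rightarrow> (nat \<Rightarrow> real \<Rightarrow> 'v \<Rightarrow> real ^ 'd) \<Rightarrow> (nat \<Rightarrow> real \<Rightarrow> 'v \<Rightarrow> real ^ 'd ^ 'd) \<Rightarrow>
     'w measure \<Rightarrow> (real \<Rightarrow> 'w \<Rightarrow> real ^ 'd) \<Rightarrow> (real \<Rightarrow> 'w \<Rightarrow> real ^ 'd ^ 'd) \<Rightarrow> bool"
  where "iterated_invariance_principle M S SS M' B BB \<longleftrightarrow>
    prob_space M \<and> prob_space M' \<and>
    (\<forall>N\<ge>1. \<forall>t\<ge>0. S N t \<in> borel_measurable M \<and> SS N t \<in> borel_measurable M) \<and>
    (\<forall>t\<ge>0. B t \<in> borel_measurable M' \<and> BB t \<in> borel_measurable M') \<and>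
    (\<forall>t\<ge>0. converges_in_law M (\<lambda>N \<omega>. (S N t \<omega>, SS N t \<omega>)) M' (\<lambda>\<omega>. (B t \<omega>, BB t \<omega>))) \<and>
    (\<forall>N\<ge>1. integrable M (\<lambda>\<omega>. S N 1 \<omega> \<otimes>\<^sub>t S N 1 \<omega>) \<and> integrable M (SS N 1)) \<and>
    integrable M' (\<lambda>\<omega>. B 1 \<omega> \<otimes>\<^sub>t B 1 \<omega>) \<and> integrable M' (BB 1) \<and>
    (\<lambda>N. \<integral>\<omega>. S N 1 \<omega> \<otimes>\<^sub>t S N 1 \<omega> \<partial>M) \<longlonglongrightarrow> (\<integral>\<omega>. B 1 \<omega> \<otimes>\<^sub>t B 1 \<omega> \<partial>M') \<and>
    (\<lambda>N. \<integral>\<omega>. SS N 1 \<omega> \<partial>M) \<longlonglongrightarrow> (\<integral>\<omega>. BB 1 \<omega> \<partial>M')"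

end

theory Submission
  imports Defs
begin

text \<open>
  Write \<open>\<Delta> s = E(\<Xi> 0 \<otimes> \<Xi> s)\<close>. Convergence of expectations is part of the invariance principle, so both
  characteristics of the limit can be read off from explicit second moments of \<open>\<Xi>\<close>.

  For \<open>\<Gamma>\<close>: the path \<open>S_N\<close> is absolutely continuous, so the Riemann-Stieltjes integral \<open>SS_N(1)\<close> equals
  \<open>1/N\<close> times the integral of \<open>\<Xi> r \<otimes> \<Xi> u\<close> over the triangle \<open>0 \<le> r \<le> u \<le> N\<close>. By Fubini and
  stationarity its mean is \<open>1/N \<integral>\<^sub>0\<^sup>N D(u) du\<close>, where \<open>D(u) = \<integral>\<^sub>0\<^sup>u \<Delta>(s) ds\<close>. This is the Cesaro mean of a
  function that converges to \<open>\<integral>\<^sub>0\<^sup>\<infinity> \<Delta>\<close>, so it has the same limit. On the other side, Ito integrals are \<open>L\<^sup>2\<close> limits of centred variables, so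
  \<open>E(BB 1) = \<Gamma>\<close>.

  For \<open>\<Sigma>\<close>: integration by parts gives \<open>S_N(1) \<otimes> S_N(1) = SS_N(1) + SS_N(1)\<^sup>T\<close> almost surely. Taking
  expectations and limits, \<open>\<Sigma> = E(B 1 \<otimes> B 1) = \<Gamma> + \<Gamma>\<^sup>T\<close>.

  For the area correction: the covariation of the components of \<open>B\<close> over \<open>[0, 1]\<close> is \<open>\<Sigma>\<close>, because the
  sum of products of increments has variance of the order of the mesh. Hence the Stratonovich
  integral is the Ito integral \<open>BB 1 - \<Gamma>\<close> plus \<open>\<Sigma> / 2 = Sym \<Gamma>\<close>, and \<open>BB 1\<close> exceeds it by
  \<open>\<Gamma> - Sym \<Gamma> = Anti \<Gamma>\<close>. Integrals and covariations are given as relations, so a statement about every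
  version of the Stratonovich integral needs that both are unique up to null sets. For the Ito
  integral this is the isometry, in the form \<open>ito_isometry\<close>, applied to the difference of two
  approximating elementary integrals.
\<close>

section \<open>Riemann-Stieltjes integrals\<close>

lemma is_partition_mono:
  assumes "is_partition a b n \<tau>" "i \<le> j" "j \<le> n"
  shows "\<tau> i \<le> \<tau> j"
  using assms(2,3)
proof (induction rule: dec_induct)
  case (step m)
  then have "\<tau> m \<le> \<tau> (Suc m)"
    using assms(1) by (auto simp: is_partition_def)
  with step show ?case by auto
qed simp

lemma is_partition_bounds:
  assumes "is_partition a b n \<tau>" "i \<le> n"
  shows "a \<le> \<tau> i" "\<tau> i \<le> b"
  using is_partition_mono[OF assms(1), of 0 i] is_partition_mono[OF assms(1), of i n] assms
  by (auto simp: is_partition_def)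

lemma fine_partition_exists:
  fixes a b \<delta> :: real
  assumes "a \<le> b" "\<delta> > 0"
  obtains n \<tau> where "is_partition a b n \<tau>" "\<And>k. k < n \<Longrightarrow> \<tau> (Suc k) - \<tau> k < \<delta>"
proof -
  obtain n :: nat where n: "(b - a) / \<delta> < real n"
    using reals_Archimedean2 by blast
  have "real n > 0"
    using n assms by (smt (verit) divide_nonneg_pos)
  define \<tau> where "\<tau> k = a + real k * (b - a) / real n" for k
  have step: "\<tau> (Suc k) - \<tau> k = (b - a) / real n" for k
    by (simp add: \<tau>_def add_divide_distrib[symmetric] diff_divide_distrib[symmetric] algebra_simps)
  have "(b - a) / real n < \<delta>" "0 \<le> (b - a) / real n"
    using n \<open>real n > 0\<close> assms by (auto simp: field_simps)
  then have "is_partition a b n \<tau>" "\<And>k. k < n \<Longrightarrow> \<tau> (Suc k) - \<tau> k < \<delta>"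
    using step \<open>real n > 0\<close> unfolding is_partition_def
    by (auto simp: \<tau>_def) (smt (verit) step \<tau>_def)
  then show ?thesis by (rule that)
qed

lemma has_rs_integralE:
  assumes "has_rs_integral f g a b I" "\<epsilon> > 0"
  obtains \<delta> where "\<delta> > 0" "\<And>n \<tau> \<xi>. is_partition a b n \<tau> \<Longrightarrow>
      (\<forall>k<n. \<tau> (Suc k) - \<tau> k < \<delta> \<and> \<xi> k \<in> {\<tau> k..\<tau> (Suc k)}) \<Longrightarrow>
      \<bar>(\<Sum>k<n. f (\<xi> k) * (g (\<tau> (Suc k)) - g (\<tau> k))) - I\<bar> < \<epsilon>"
proof -
  have "\<exists>\<delta>>0. \<forall>n \<tau> \<xi>. is_partition a b n \<tau> \<and>
      (\<forall>k<n. \<tau> (Suc k) - \<tau> k < \<delta> \<and> \<xi> k \<in> {\<tau> k..\<tau> (Suc k)}) \<longrightarrow>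
      \<bar>(\<Sum>k<n. f (\<xi> k) * (g (\<tau> (Suc k)) - g (\<tau> k))) - I\<bar> < \<epsilon>"
    using assms(1) unfolding has_rs_integral_def using assms(2) by (elim allE impE)
  then show ?thesis using that by (elim exE conjE) blast
qed

lemma has_rs_integral_unique:
  assumes "has_rs_integral f g a b I" "has_rs_integral f g a b J" "a \<le> b"
  shows "I = J"
proof (rule ccontr)
  assume "I \<noteq> J"
  then have pos: "\<bar>I - J\<bar> / 2 > 0" by simp
  obtain \<delta> where "\<delta> > 0"
    and I: "\<And>n \<tau> \<xi>. is_partition a b n \<tau> \<Longrightarrow> (\<forall>k<n. \<tau> (Suc k) - \<tau> k < \<delta> \<and> \<xi> k \<in> {\<tau> k..\<tau> (Suc k)}) \<Longrightarrow>
       \<bar>(\<Sum>k<n. f (\<xi> k) * (g (\<tau> (Suc k)) - g (\<tau> k))) - I\<bar> < \<bar>I - J\<bar> / 2"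
    using has_rs_integralE[OF assms(1) pos] by blast
  obtain \<delta>' where "\<delta>' > 0"
    and J: "\<And>n \<tau> \<xi>. is_partition a b n \<tau> \<Longrightarrow> (\<forall>k<n. \<tau> (Suc k) - \<tau> k < \<delta>' \<and> \<xi> k \<in> {\<tau> k..\<tau> (Suc k)}) \<Longrightarrow>
       \<bar>(\<Sum>k<n. f (\<xi> k) * (g (\<tau> (Suc k)) - g (\<tau> k))) - J\<bar> < \<bar>I - J\<bar> / 2"
    using has_rs_integralE[OF assms(2) pos] by blast
  obtain n \<tau> where \<tau>: "is_partition a b n \<tau>" "\<And>k. k < n \<Longrightarrow> \<tau> (Suc k) - \<tau> k < min \<delta> \<delta>'"
    using fine_partition_exists[of a b "min \<delta> \<delta>'"] assms(3) \<open>\<delta> > 0\<close> \<open>\<delta>' > 0\<close> by auto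
  have "\<bar>(\<Sum>k<n. f (\<tau> k) * (g (\<tau> (Suc k)) - g (\<tau> k))) - I\<bar> < \<bar>I - J\<bar> / 2"
    and "\<bar>(\<Sum>k<n. f (\<tau> k) * (g (\<tau> (Suc k)) - g (\<tau> k))) - J\<bar> < \<bar>I - J\<bar> / 2"
    using \<tau> by (intro I J; auto simp: is_partition_def)+
  then show False by (simp add: abs_if split: if_splits)
qed

lemma rs_integral_eqI:
  assumes "has_rs_integral f g a b I" "a \<le> b"
  shows "rs_integral f g a b = I"
  unfolding rs_integral_def using has_rs_integral_unique assms by blast

text \<open>
  On a common fine partition, left tags for one integral and right tags for the other make the sum of
  the two Riemann-Stieltjes sums telescope to the boundary term.
\<close>

lemma has_rs_integral_by_parts:
  assumes "has_rs_integral f g a b I" "has_rs_integral g f a b J" "a \<le> b"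
  shows "I + J = f b * g b - f a * g a"
proof -
  have "\<bar>I + J - (f b * g b - f a * g a)\<bar> < e" if "e > 0" for e
  proof -
    from that have pos: "e / 2 > 0" by simp
    obtain \<delta> where "\<delta> > 0"
      and I: "\<And>n \<tau> \<xi>. is_partition a b n \<tau> \<Longrightarrow> (\<forall>k<n. \<tau> (Suc k) - \<tau> k < \<delta> \<and> \<xi> k \<in> {\<tau> k..\<tau> (Suc k)}) \<Longrightarrow>
         \<bar>(\<Sum>k<n. f (\<xi> k) * (g (\<tau> (Suc k)) - g (\<tau> k))) - I\<bar> < e / 2"
      using has_rs_integralE[OF assms(1) pos] by blast
    obtain \<delta>' where "\<delta>' > 0"
      and J: "\<And>n \<tau> \<xi>. is_partition a b n \<tau> \<Longrightarrow> (\<forall>k<n. \<tau> (Suc k) - \<tau> k < \<delta>' \<and> \<xi> k \<in> {\<tau> k..\<tau> (Suc k)}) \<Longrightarrow>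
         \<bar>(\<Sum>k<n. g (\<xi> k) * (f (\<tau> (Suc k)) - f (\<tau> k))) - J\<bar> < e / 2"
      using has_rs_integralE[OF assms(2) pos] by blast
    obtain n \<tau> where \<tau>: "is_partition a b n \<tau>" "\<And>k. k < n \<Longrightarrow> \<tau> (Suc k) - \<tau> k < min \<delta> \<delta>'"
      using fine_partition_exists[of a b "min \<delta> \<delta>'"] assms(3) \<open>\<delta> > 0\<close> \<open>\<delta>' > 0\<close> by auto
    have "\<bar>(\<Sum>k<n. f (\<tau> k) * (g (\<tau> (Suc k)) - g (\<tau> k))) - I\<bar> < e / 2"
      and "\<bar>(\<Sum>k<n. g (\<tau> (Suc k)) * (f (\<tau> (Suc k)) - f (\<tau> k))) - J\<bar> < e / 2"
      using \<tau> I[of n \<tau> \<tau>] J[of n \<tau> "\<lambda>k. \<tau> (Suc k)"] by (auto simp: is_partition_def)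
    moreover have "(\<Sum>k<n. f (\<tau> k) * (g (\<tau> (Suc k)) - g (\<tau> k)))
        + (\<Sum>k<n. g (\<tau> (Suc k)) * (f (\<tau> (Suc k)) - f (\<tau> k)))
        = (\<Sum>k<n. f (\<tau> (Suc k)) * g (\<tau> (Suc k)) - f (\<tau> k) * g (\<tau> k))"
      unfolding sum.distrib[symmetric] by (intro sum.cong) (auto simp: algebra_simps)
    moreover have "\<dots> = f b * g b - f a * g a"
      using sum_lessThan_telescope[of "\<lambda>k. f (\<tau> k) * g (\<tau> k)" n] \<tau>(1)
      by (simp add: is_partition_def)
    ultimately show ?thesis by linarith
  qed
  from this[of "\<bar>I + J - (f b * g b - f a * g a)\<bar>"] show ?thesis by auto
qed

lemma has_rs_integral_rescale:
  assumes "has_rs_integral f g 0 L I" "L > 0"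
  shows "has_rs_integral (\<lambda>s. c * f (L * s)) (\<lambda>s. c * g (L * s)) 0 1 (c\<^sup>2 * I)"
  unfolding has_rs_integral_def
proof (intro allI impI)
  fix e :: real assume "e > 0"
  define e' where "e' = e / (c\<^sup>2 + 1)"
  have pos: "c\<^sup>2 + 1 > 0" by (smt (verit) zero_le_power2)
  then have "e' > 0" using \<open>e > 0\<close> by (simp add: e'_def)
  from has_rs_integralE[OF assms(1) this] obtain \<delta> where "\<delta> > 0"
    and I: "\<And>n \<tau> \<xi>. is_partition 0 L n \<tau> \<Longrightarrow> (\<forall>k<n. \<tau> (Suc k) - \<tau> k < \<delta> \<and> \<xi> k \<in> {\<tau> k..\<tau> (Suc k)}) \<Longrightarrow>
       \<bar>(\<Sum>k<n. f (\<xi> k) * (g (\<tau> (Suc k)) - g (\<tau> k))) - I\<bar> < e'" by blast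
  have "\<bar>(\<Sum>k<n. c * f (L * \<xi> k) * (c * g (L * \<tau> (Suc k)) - c * g (L * \<tau> k))) - c\<^sup>2 * I\<bar> < e"
    if "is_partition 0 1 n \<tau>" "\<forall>k<n. \<tau> (Suc k) - \<tau> k < \<delta> / L \<and> \<xi> k \<in> {\<tau> k..\<tau> (Suc k)}" for n \<tau> \<xi>
  proof -
    have "is_partition 0 L n (\<lambda>k. L * \<tau> k)"
      using that(1) assms(2) by (auto simp: is_partition_def)
    moreover have "\<forall>k<n. L * \<tau> (Suc k) - L * \<tau> k < \<delta> \<and> L * \<xi> k \<in> {L * \<tau> k..L * \<tau> (Suc k)}"
      using that(2) assms(2) by (auto simp: field_simps)
    ultimately have *: "\<bar>(\<Sum>k<n. f (L * \<xi> k) * (g (L * \<tau> (Suc k)) - g (L * \<tau> k))) - I\<bar> < e'"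
      by (rule I)
    have "(\<Sum>k<n. c * f (L * \<xi> k) * (c * g (L * \<tau> (Suc k)) - c * g (L * \<tau> k))) - c\<^sup>2 * I
        = c\<^sup>2 * ((\<Sum>k<n. f (L * \<xi> k) * (g (L * \<tau> (Suc k)) - g (L * \<tau> k))) - I)"
      by (simp add: sum_distrib_left right_diff_distrib power2_eq_square mult_ac)
    then have "\<bar>(\<Sum>k<n. c * f (L * \<xi> k) * (c * g (L * \<tau> (Suc k)) - c * g (L * \<tau> k))) - c\<^sup>2 * I\<bar>
        = c\<^sup>2 * \<bar>(\<Sum>k<n. f (L * \<xi> k) * (g (L * \<tau> (Suc k)) - g (L * \<tau> k))) - I\<bar>"
      by (simp add: abs_mult)
    also have "\<dots> \<le> c\<^sup>2 * e'" using * by (intro mult_left_mono) auto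
    also have "\<dots> < (c\<^sup>2 + 1) * e'" using \<open>e' > 0\<close> by simp
    also have "\<dots> = e" using pos by (simp add: e'_def)
    finally show ?thesis .
  qed
  then show "\<exists>\<delta>>0. \<forall>n \<tau> \<xi>. is_partition 0 1 n \<tau> \<and>
      (\<forall>k<n. \<tau> (Suc k) - \<tau> k < \<delta> \<and> \<xi> k \<in> {\<tau> k..\<tau> (Suc k)}) \<longrightarrow>
      \<bar>(\<Sum>k<n. c * f (L * \<xi> k) * (c * g (L * \<tau> (Suc k)) - c * g (L * \<tau> k))) - c\<^sup>2 * I\<bar> < e"
    using \<open>\<delta> > 0\<close> assms(2) by (intro exI[of _ "\<delta> / L"]) auto
qed

text \<open>
  Together with telescoping, this splits an integral over \<open>[0, L]\<close> along a partition without a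
  separate induction.
\<close>

lemma set_integral_Icc_diff:
  fixes h :: "real \<Rightarrow> real"
  assumes "set_integrable lborel {0..L} h" "0 \<le> a" "a \<le> b" "b \<le> L"
  shows "(LINT s:{0..b}|lborel. h s) - (LINT s:{0..a}|lborel. h s) = (LINT s:{a<..b}|lborel. h s)"
proof -
  have "{0..b} = {0..a} \<union> {a<..b}" "{0..a} \<inter> {a<..b} = {}" using assms by auto
  moreover have "set_integrable lborel {0..a} h" "set_integrable lborel {a<..b} h"
    using assms by (auto intro!: set_integrable_subset[OF assms(1)])
  ultimately show ?thesis using set_integral_Un[of "{0..a}" "{a<..b}" lborel h] by simp
qed

lemma set_integral_point: "(LINT s:{a..a}|lborel. h s) = (0::real)" for a :: real
  unfolding set_lebesgue_integral_def
  by (intro integral_eq_zero_AE AE_I[of _ _ "{a}"]) (auto simp: indicator_def)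

text \<open>
  On each piece of a fine partition, replacing \<open>f (\<xi> k)\<close> by \<open>f s\<close> under the integral of \<open>y\<close> costs at most
  the oscillation of \<open>f\<close> times the integral of \<open>\<bar>y\<bar>\<close> over the piece, and these costs add up to an
  arbitrarily small multiple of the \<open>L\<^sup>1\<close> norm of \<open>y\<close>.
\<close>

lemma has_rs_integral_indefinite_integral:
  fixes f y :: "real \<Rightarrow> real"
  assumes y: "set_integrable lborel {0..L} y" and f: "continuous_on {0..L} f"
  shows "has_rs_integral f (\<lambda>v. LINT s:{0..v}|lborel. y s) 0 L (LINT s:{0..L}|lborel. f s * y s)"
  unfolding has_rs_integral_def
proof (intro allI impI)
  fix e :: real assume "e > 0"
  define A where "A = (LINT s:{0..L}|lborel. \<bar>y s\<bar>)"
  have "A \<ge> 0" unfolding A_def set_lebesgue_integral_def by (intro integral_nonneg_AE) auto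
  define \<eta> where "\<eta> = e / (A + 1)"
  have "\<eta> > 0" using \<open>e > 0\<close> \<open>A \<ge> 0\<close> by (simp add: \<eta>_def)
  have "uniformly_continuous_on {0..L} f"
    using f by (intro compact_uniformly_continuous) auto
  then obtain \<delta> where "\<delta> > 0" and \<delta>: "\<And>s t. s \<in> {0..L} \<Longrightarrow> t \<in> {0..L} \<Longrightarrow> \<bar>s - t\<bar> < \<delta> \<Longrightarrow> \<bar>f s - f t\<bar> < \<eta>"
    using \<open>\<eta> > 0\<close> unfolding uniformly_continuous_on_def dist_real_def by metis
  have fy: "set_integrable lborel {0..L} (\<lambda>s. f s * y s)"
  proof -
    have "bounded (f ` {0..L})" using f by (intro compact_imp_bounded compact_continuous_image) auto
    then obtain K where K: "\<And>s. s \<in> {0..L} \<Longrightarrow> \<bar>f s\<bar> \<le> K" unfolding bounded_iff by (auto simp del: atLeastAtMost_iff)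
    have "(\<lambda>s. indicator {0..L} s * f s) \<in> borel_measurable borel"
      using borel_measurable_continuous_on_indicator[OF _ f] by simp
    moreover have "(\<lambda>s. indicator {0..L} s * y s) \<in> borel_measurable borel"
      using y unfolding set_integrable_def by auto
    ultimately have "(\<lambda>s. (indicator {0..L} s * f s) * (indicator {0..L} s * y s)) \<in> borel_measurable borel"
      by measurable
    also have "(\<lambda>s. (indicator {0..L} s * f s) * (indicator {0..L} s * y s)) =
        (\<lambda>s. indicator {0..L} s * (f s * y s))"
      by (auto simp: indicator_def)
    finally have meas: "(\<lambda>s. indicator {0..L} s * (f s * y s)) \<in> borel_measurable borel" .
    have bound: "\<bar>indicator {0..L} s * (f s * y s)\<bar> \<le> \<bar>K * (indicator {0..L} s * y s)\<bar>" for s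
    proof (cases "s \<in> {0..L}")
      case True
      then have "\<bar>f s\<bar> \<le> \<bar>K\<bar>" using K[of s] by linarith
      with True show ?thesis by (simp add: abs_mult mult_right_mono)
    qed simp
    have "integrable lborel (\<lambda>s. K * (indicator {0..L} s * y s))"
      using y by (simp add: set_integrable_def)
    then show ?thesis
      unfolding set_integrable_def using meas bound
      by (elim Bochner_Integration.integrable_bound) auto
  qed
  have ay: "set_integrable lborel {0..L} (\<lambda>s. \<bar>y s\<bar>)"
    using y by (rule set_integrable_abs)
  have "\<bar>(\<Sum>k<n. f (\<xi> k) * ((LINT s:{0..\<tau> (Suc k)}|lborel. y s) - (LINT s:{0..\<tau> k}|lborel. y s)))
        - (LINT s:{0..L}|lborel. f s * y s)\<bar> < e"
    if p: "is_partition 0 L n \<tau>" and m: "\<forall>k<n. \<tau> (Suc k) - \<tau> k < \<delta> \<and> \<xi> k \<in> {\<tau> k..\<tau> (Suc k)}" for n \<tau> \<xi>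
  proof -
    have ends: "\<tau> 0 = 0" "\<tau> n = L" using p by (auto simp: is_partition_def)
    have tele: "(LINT s:{0..L}|lborel. h s) = (\<Sum>k<n. LINT s:{\<tau> k<..\<tau> (Suc k)}|lborel. h s)"
      if h: "set_integrable lborel {0..L} h" for h :: "real \<Rightarrow> real"
    proof -
      have "(\<Sum>k<n. LINT s:{\<tau> k<..\<tau> (Suc k)}|lborel. h s)
          = (\<Sum>k<n. (LINT s:{0..\<tau> (Suc k)}|lborel. h s) - (LINT s:{0..\<tau> k}|lborel. h s))"
        using is_partition_bounds[OF p] is_partition_mono[OF p]
        by (intro sum.cong refl set_integral_Icc_diff[OF h, symmetric]) auto
      also have "\<dots> = (LINT s:{0..L}|lborel. h s)"
        using sum_lessThan_telescope[of "\<lambda>k. (LINT s:{0..\<tau> k}|lborel. h s)" n]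
          set_integral_point[of 0 h] by (simp add: ends)
      finally show ?thesis ..
    qed
    have piece: "\<bar>f (\<xi> k) * ((LINT s:{0..\<tau> (Suc k)}|lborel. y s) - (LINT s:{0..\<tau> k}|lborel. y s))
        - (LINT s:{\<tau> k<..\<tau> (Suc k)}|lborel. f s * y s)\<bar> \<le> \<eta> * (LINT s:{\<tau> k<..\<tau> (Suc k)}|lborel. \<bar>y s\<bar>)"
      if "k < n" for k
    proof -
      have bd: "0 \<le> \<tau> k" "\<tau> k \<le> \<tau> (Suc k)" "\<tau> (Suc k) \<le> L"
        using that is_partition_bounds[OF p] is_partition_mono[OF p] by auto
      have sub: "set_integrable lborel {\<tau> k<..\<tau> (Suc k)} h" if "set_integrable lborel {0..L} h"
        for h :: "real \<Rightarrow> real"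
        using bd by (auto intro!: set_integrable_subset[OF that])
      have "f (\<xi> k) * (LINT s:{\<tau> k<..\<tau> (Suc k)}|lborel. y s)
          - (LINT s:{\<tau> k<..\<tau> (Suc k)}|lborel. f s * y s)
        = (LINT s:{\<tau> k<..\<tau> (Suc k)}|lborel. f (\<xi> k) * y s - f s * y s)"
        using sub[OF y] sub[OF fy] by simp
      also have "\<bar>\<dots>\<bar> \<le> (LINT s:{\<tau> k<..\<tau> (Suc k)}|lborel. \<bar>f (\<xi> k) * y s - f s * y s\<bar>)"
        using set_integral_norm_bound[of lborel "{\<tau> k<..\<tau> (Suc k)}" "\<lambda>s. f (\<xi> k) * y s - f s * y s"]
          sub[OF y] sub[OF fy] by simp
      also have "\<dots> \<le> (LINT s:{\<tau> k<..\<tau> (Suc k)}|lborel. \<eta> * \<bar>y s\<bar>)"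
      proof (rule set_integral_mono)
        show "set_integrable lborel {\<tau> k<..\<tau> (Suc k)} (\<lambda>s. \<bar>f (\<xi> k) * y s - f s * y s\<bar>)"
          using sub[OF y] sub[OF fy] by (intro set_integrable_abs set_integral_diff(1)) auto
        show "set_integrable lborel {\<tau> k<..\<tau> (Suc k)} (\<lambda>s. \<eta> * \<bar>y s\<bar>)"
          using sub[OF ay] by auto
        fix s assume s: "s \<in> {\<tau> k<..\<tau> (Suc k)}"
        have "\<bar>f (\<xi> k) - f s\<bar> \<le> \<eta>"
          using s m that bd by (intro less_imp_le \<delta>) force+
        then show "\<bar>f (\<xi> k) * y s - f s * y s\<bar> \<le> \<eta> * \<bar>y s\<bar>"
          by (simp add: left_diff_distrib[symmetric] abs_mult mult_right_mono)
      qed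
      finally show ?thesis
        using set_integral_Icc_diff[OF y bd] by simp
    qed
    have "\<bar>(\<Sum>k<n. f (\<xi> k) * ((LINT s:{0..\<tau> (Suc k)}|lborel. y s) - (LINT s:{0..\<tau> k}|lborel. y s)))
        - (LINT s:{0..L}|lborel. f s * y s)\<bar> \<le> (\<Sum>k<n. \<eta> * (LINT s:{\<tau> k<..\<tau> (Suc k)}|lborel. \<bar>y s\<bar>))"
      unfolding tele[OF fy] sum_subtractf[symmetric]
      by (rule order_trans[OF sum_abs sum_mono]) (use piece in auto)
    also have "\<dots> = \<eta> * A" unfolding A_def tele[OF ay] sum_distrib_left ..
    also have "\<dots> < \<eta> * (A + 1)" using \<open>\<eta> > 0\<close> by simp
    also have "\<dots> = e" using \<open>A \<ge> 0\<close> by (simp add: \<eta>_def)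
    finally show ?thesis .
  qed
  then show "\<exists>\<delta>>0. \<forall>n \<tau> \<xi>. is_partition 0 L n \<tau> \<and>
      (\<forall>k<n. \<tau> (Suc k) - \<tau> k < \<delta> \<and> \<xi> k \<in> {\<tau> k..\<tau> (Suc k)}) \<longrightarrow>
      \<bar>(\<Sum>k<n. f (\<xi> k) * ((LINT s:{0..\<tau> (Suc k)}|lborel. y s) - (LINT s:{0..\<tau> k}|lborel. y s)))
        - (LINT s:{0..L}|lborel. f s * y s)\<bar> < e"
    using \<open>\<delta> > 0\<close> by blast
qed

section \<open>Moments and independence of Brownian increments\<close>

lemma centered_gaussian_vector_linear_moments:
  assumes "prob_space M" "centered_gaussian_vector M X C"
  shows "integrable M (\<lambda>\<omega>. (u \<bullet> X \<omega>)^2)" "(\<integral>\<omega>. (u \<bullet> X \<omega>)^2 \<partial>M) = u \<bullet> (C *v u)"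
    and "integrable M (\<lambda>\<omega>. (u \<bullet> X \<omega>)^4)" "(\<integral>\<omega>. (u \<bullet> X \<omega>)^4 \<partial>M) = 3 * (u \<bullet> (C *v u))\<^sup>2"
    and "integrable M (\<lambda>\<omega>. u \<bullet> X \<omega>)" "(\<integral>\<omega>. u \<bullet> X \<omega> \<partial>M) = 0"
proof -
  interpret prob_space M by fact
  define q where "q = u \<bullet> (C *v u)"
  have q: "0 \<le> q" and X[measurable]: "X \<in> borel_measurable M"
    and D: "if q = 0 then AE \<omega> in M. u \<bullet> X \<omega> = 0
         else distributed M lborel (\<lambda>\<omega>. u \<bullet> X \<omega>) (normal_density 0 (sqrt q))"
    using assms(2) unfolding centered_gaussian_vector_def q_def by auto
  have "has_bochner_integral M (\<lambda>\<omega>. (u \<bullet> X \<omega>)^2) q \<and> has_bochner_integral M (\<lambda>\<omega>. (u \<bullet> X \<omega>)^4) (3 * q\<^sup>2)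
    \<and> has_bochner_integral M (\<lambda>\<omega>. u \<bullet> X \<omega>) 0"
  proof (cases "q = 0")
    case True
    then have ae: "AE \<omega> in M. u \<bullet> X \<omega> = 0" using D by simp
    have "has_bochner_integral M (\<lambda>\<omega>. (u \<bullet> X \<omega>)^2) 0" "has_bochner_integral M (\<lambda>\<omega>. (u \<bullet> X \<omega>)^4) 0"
      "has_bochner_integral M (\<lambda>\<omega>. u \<bullet> X \<omega>) 0"
      using ae by (subst has_bochner_integral_cong_AE[where g="\<lambda>_. 0"]; force)+
    then show ?thesis using True by simp
  next
    case False
    with q have "q > 0" by simp
    from False D have D: "distributed M lborel (\<lambda>\<omega>. u \<bullet> X \<omega>) (normal_density 0 (sqrt q))" by simp
    have tr: "has_bochner_integral M (\<lambda>\<omega>. g (u \<bullet> X \<omega>)) c"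
      if "has_bochner_integral lborel (\<lambda>x. normal_density 0 (sqrt q) x * g x) c" and [measurable]: "g \<in> borel_measurable borel"
      for g and c :: real
      using that distributed_integrable[OF D, of g] distributed_integral[OF D, of g]
      by (simp add: has_bochner_integral_iff)
    have "has_bochner_integral M (\<lambda>\<omega>. (u \<bullet> X \<omega>)^2) q"
      using normal_moment_even[where \<mu>=0 and \<sigma>="sqrt q" and k=1] \<open>q > 0\<close>
      by (intro tr) (simp_all add: fact_numeral)
    moreover have "has_bochner_integral M (\<lambda>\<omega>. (u \<bullet> X \<omega>)^4) (3 * q\<^sup>2)"
      using normal_moment_even[where \<mu>=0 and \<sigma>="sqrt q" and k=2] \<open>q > 0\<close>
      by (intro tr) (simp_all add: fact_numeral power_divide)
    moreover have "has_bochner_integral M (\<lambda>\<omega>. u \<bullet> X \<omega>) 0"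
      using normal_moment_odd[where \<mu>=0 and \<sigma>="sqrt q" and k=0] \<open>q > 0\<close>
      by (intro tr) simp_all
    ultimately show ?thesis by blast
  qed
  then show "integrable M (\<lambda>\<omega>. (u \<bullet> X \<omega>)^2)" "(\<integral>\<omega>. (u \<bullet> X \<omega>)^2 \<partial>M) = u \<bullet> (C *v u)"
    "integrable M (\<lambda>\<omega>. (u \<bullet> X \<omega>)^4)" "(\<integral>\<omega>. (u \<bullet> X \<omega>)^4 \<partial>M) = 3 * (u \<bullet> (C *v u))\<^sup>2"
    "integrable M (\<lambda>\<omega>. u \<bullet> X \<omega>)" "(\<integral>\<omega>. u \<bullet> X \<omega> \<partial>M) = 0"
    by (auto simp: has_bochner_integral_iff q_def)
qed

lemma axis_quadratic_form:
  fixes C :: "real ^ 'd ^ 'd"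
  shows "axis i 1 \<bullet> (C *v axis j 1) = C $ i $ j"
  by (simp add: inner_axis' matrix_vector_mult_basis column_def)

text \<open>
  The definition controls only the scalar variables \<open>u \<bullet> X\<close>; mixed moments are recovered by
  polarisation. Fourth moments are needed for the covariation.
\<close>

lemma centered_gaussian_vector_moments:
  fixes X :: "'w \<Rightarrow> real ^ 'd"
  assumes "prob_space M" "centered_gaussian_vector M X C"
  shows "integrable M (\<lambda>\<omega>. X \<omega> $ i)" "(\<integral>\<omega>. X \<omega> $ i \<partial>M) = 0"
    and "integrable M (\<lambda>\<omega>. X \<omega> $ i * X \<omega> $ j)" "(\<integral>\<omega>. X \<omega> $ i * X \<omega> $ j \<partial>M) = C $ i $ j"
    and "integrable M (\<lambda>\<omega>. (X \<omega> $ i)^4)" "(\<integral>\<omega>. (X \<omega> $ i)^4 \<partial>M) = 3 * (C $ i $ i)\<^sup>2"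
proof -
  note L = centered_gaussian_vector_linear_moments[OF assms]
  have sym: "C $ j $ i = C $ i $ j"
    using assms(2) unfolding centered_gaussian_vector_def transpose_def by (metis vec_lambda_beta)
  show "integrable M (\<lambda>\<omega>. X \<omega> $ i)" "(\<integral>\<omega>. X \<omega> $ i \<partial>M) = 0"
    "integrable M (\<lambda>\<omega>. (X \<omega> $ i)^4)" "(\<integral>\<omega>. (X \<omega> $ i)^4 \<partial>M) = 3 * (C $ i $ i)\<^sup>2"
    using L(3-6)[of "axis i 1"] unfolding axis_quadratic_form by (simp_all add: inner_axis')
  have pol: "X \<omega> $ i * X \<omega> $ j =
    (((axis i 1 + axis j 1) \<bullet> X \<omega>)^2 - (axis i 1 \<bullet> X \<omega>)^2 - (axis j 1 \<bullet> X \<omega>)^2) / 2" for \<omega>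
    by (simp add: inner_axis' power2_eq_square algebra_simps)
  show "integrable M (\<lambda>\<omega>. X \<omega> $ i * X \<omega> $ j)" "(\<integral>\<omega>. X \<omega> $ i * X \<omega> $ j \<partial>M) = C $ i $ j"
    unfolding pol using L(1,2)[of "axis i 1"] L(1,2)[of "axis j 1"] L(1,2)[of "axis i 1 + axis j 1"] sym
    by (simp_all add: inner_add_left inner_add_right matrix_vector_right_distrib axis_quadratic_form)
qed

lemma brownian_motionD:
  assumes "brownian_motion M B \<Sigma>"
  shows "prob_space M" "\<And>t. 0 \<le> t \<Longrightarrow> B t \<in> borel_measurable M" "AE \<omega> in M. B 0 \<omega> = 0"
    "AE \<omega> in M. continuous_on {0..} (\<lambda>t. B t \<omega>)"
    "\<And>s t. 0 \<le> s \<Longrightarrow> s \<le> t \<Longrightarrow> centered_gaussian_vector M (\<lambda>\<omega>. B t \<omega> - B s \<omega>) ((t - s) *\<^sub>R \<Sigma>)"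
    "\<And>s t. 0 \<le> s \<Longrightarrow> s \<le> t \<Longrightarrow> prob_space.indep_set M (sets (natural_filtration M B s))
         (sets (vimage_algebra (space M) (\<lambda>\<omega>. B t \<omega> - B s \<omega>) borel))"
  using assms unfolding brownian_motion_def by auto

lemma space_natural_filtration [simp]: "space (natural_filtration M X t) = space M"
  unfolding natural_filtration_def by (rule space_measure_of) auto

lemma sets_natural_filtration:
  "sets (natural_filtration M X t) =
    sigma_sets (space M) {X s -` A \<inter> space M |s A. 0 \<le> s \<and> s \<le> t \<and> A \<in> sets borel}"
  unfolding natural_filtration_def by (rule sets_measure_of) auto

lemma natural_filtration_mono:
  "s \<le> t \<Longrightarrow> sets (natural_filtration M X s) \<subseteq> sets (natural_filtration M X t)"
  unfolding sets_natural_filtration by (intro sigma_sets_mono') force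

lemma measurable_natural_filtration_mono:
  assumes "f \<in> borel_measurable (natural_filtration M X s)" "s \<le> t"
  shows "f \<in> borel_measurable (natural_filtration M X t)"
  using assms natural_filtration_mono[OF assms(2), of M X] by (auto simp: measurable_def)

lemma measurable_natural_filtration_process:
  assumes "0 \<le> s" "s \<le> t"
  shows "X s \<in> borel_measurable (natural_filtration M X t)"
  using assms by (intro measurableI) (auto simp: sets_natural_filtration)

lemma measurable_from_natural_filtration:
  assumes "\<And>s. 0 \<le> s \<Longrightarrow> X s \<in> borel_measurable M"
    and "f \<in> borel_measurable (natural_filtration M X t)"
  shows "f \<in> borel_measurable M"
proof -
  have "sets (natural_filtration M X t) \<subseteq> sets M"
    unfolding sets_natural_filtration
    using assms(1) by (intro sets.sigma_sets_subset) (auto intro: measurable_sets)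
  then show ?thesis using assms(2) by (auto simp: measurable_def)
qed

text \<open>
  Independence of the increments, turned into a statement on expectations: conditionally on the past,
  a function of the increment may be replaced by its mean.
\<close>

lemma brownian_increment_factorises:
  fixes B :: "real \<Rightarrow> 'w \<Rightarrow> real ^ 'd" and g :: "real ^ 'd \<Rightarrow> real"
  assumes bm: "brownian_motion M B \<Sigma>" and st: "0 \<le> s" "s \<le> t"
    and G: "G \<in> borel_measurable (natural_filtration M B s)" "integrable M G"
    and g: "g \<in> borel_measurable borel" "integrable M (\<lambda>\<omega>. g (B t \<omega> - B s \<omega>))"
  shows "integrable M (\<lambda>\<omega>. G \<omega> * g (B t \<omega> - B s \<omega>))"
    and "(\<integral>\<omega>. G \<omega> * g (B t \<omega> - B s \<omega>) \<partial>M) = (\<integral>\<omega>. G \<omega> \<partial>M) * (\<integral>\<omega>. g (B t \<omega> - B s \<omega>) \<partial>M)"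
proof -
  note bm = brownian_motionD[OF bm]
  interpret prob_space M by fact
  have "indep_var borel G borel (\<lambda>\<omega>. g (B t \<omega> - B s \<omega>))"
    unfolding indep_var_eq
  proof (intro conjI)
    show "random_variable borel G" using G(2) by auto
    show "random_variable borel (\<lambda>\<omega>. g (B t \<omega> - B s \<omega>))" using g(2) by auto
    have "indep_set (sets (natural_filtration M B s))
         (sets (vimage_algebra (space M) (\<lambda>\<omega>. B t \<omega> - B s \<omega>) borel))" using bm(6) st by auto
    then show "indep_set (sigma_sets (space M) {G -` A \<inter> space M |A. A \<in> sets borel})
       (sigma_sets (space M) {(\<lambda>\<omega>. g (B t \<omega> - B s \<omega>)) -` A \<inter> space M |A. A \<in> sets borel})"
      unfolding indep_set_def
    proof (rule indep_sets_mono_sets)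
      have "sigma_sets (space M) {G -` A \<inter> space M |A. A \<in> sets borel} \<subseteq> sets (natural_filtration M B s)"
        using sets.sigma_sets_subset[of "{G -` A \<inter> space M |A. A \<in> sets borel}" "natural_filtration M B s"]
          measurable_sets[OF G(1)] by auto
      moreover have "sigma_sets (space M) {(\<lambda>\<omega>. g (B t \<omega> - B s \<omega>)) -` A \<inter> space M |A. A \<in> sets borel}
          \<subseteq> sets (vimage_algebra (space M) (\<lambda>\<omega>. B t \<omega> - B s \<omega>) borel)"
      proof -
        have "(\<lambda>\<omega>. B t \<omega> - B s \<omega>) \<in> borel_measurable (vimage_algebra (space M) (\<lambda>\<omega>. B t \<omega> - B s \<omega>) borel)"
          by (intro measurable_vimage_algebra1) auto
        then have "(\<lambda>\<omega>. g (B t \<omega> - B s \<omega>)) \<in> borel_measurable (vimage_algebra (space M) (\<lambda>\<omega>. B t \<omega> - B s \<omega>) borel)"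
          using g(1) by (rule measurable_compose)
        from measurable_sets[OF this] show ?thesis
          using sets.sigma_sets_subset[of "{(\<lambda>\<omega>. g (B t \<omega> - B s \<omega>)) -` A \<inter> space M |A. A \<in> sets borel}"
            "vimage_algebra (space M) (\<lambda>\<omega>. B t \<omega> - B s \<omega>) borel"] by auto
      qed
      ultimately show "case_bool (sigma_sets (space M) {G -` A \<inter> space M |A. A \<in> sets borel})
         (sigma_sets (space M) {(\<lambda>\<omega>. g (B t \<omega> - B s \<omega>)) -` A \<inter> space M |A. A \<in> sets borel}) i
        \<subseteq> case_bool (sets (natural_filtration M B s))
         (sets (vimage_algebra (space M) (\<lambda>\<omega>. B t \<omega> - B s \<omega>) borel)) i" for i
        by (cases i) auto
    qed
  qed
  then show "integrable M (\<lambda>\<omega>. G \<omega> * g (B t \<omega> - B s \<omega>))"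
    "(\<integral>\<omega>. G \<omega> * g (B t \<omega> - B s \<omega>) \<partial>M) = (\<integral>\<omega>. G \<omega> \<partial>M) * (\<integral>\<omega>. g (B t \<omega> - B s \<omega>) \<partial>M)"
    using indep_var_integrable indep_var_lebesgue_integral G(2) g(2) by blast+
qed

lemma brownian_increment_moments:
  fixes B :: "real \<Rightarrow> 'w \<Rightarrow> real ^ 'd"
  assumes "brownian_motion M B \<Sigma>" "0 \<le> s" "s \<le> t"
  shows "integrable M (\<lambda>\<omega>. (B t \<omega> - B s \<omega>) $ i)" "(\<integral>\<omega>. (B t \<omega> - B s \<omega>) $ i \<partial>M) = 0"
    and "integrable M (\<lambda>\<omega>. (B t \<omega> - B s \<omega>) $ i * (B t \<omega> - B s \<omega>) $ j)"
    and "(\<integral>\<omega>. (B t \<omega> - B s \<omega>) $ i * (B t \<omega> - B s \<omega>) $ j \<partial>M) = (t - s) * \<Sigma> $ i $ j"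
    and "integrable M (\<lambda>\<omega>. ((B t \<omega> - B s \<omega>) $ i)^4)"
    and "(\<integral>\<omega>. ((B t \<omega> - B s \<omega>) $ i)^4 \<partial>M) = 3 * ((t - s) * \<Sigma> $ i $ i)\<^sup>2"
  using centered_gaussian_vector_moments[OF brownian_motionD(1)[OF assms(1)] brownian_motionD(5)[OF assms]]
  by simp_all

section \<open>Covariation of Brownian motion\<close>

lemma integrable_mult_of_squares:
  fixes X Y :: "'w \<Rightarrow> real"
  assumes [measurable]: "X \<in> borel_measurable M" "Y \<in> borel_measurable M"
    and "integrable M (\<lambda>\<omega>. (X \<omega>)\<^sup>2)" "integrable M (\<lambda>\<omega>. (Y \<omega>)\<^sup>2)"
  shows "integrable M (\<lambda>\<omega>. X \<omega> * Y \<omega>)"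
proof (rule Bochner_Integration.integrable_bound)
  show "integrable M (\<lambda>\<omega>. (X \<omega>)\<^sup>2 + (Y \<omega>)\<^sup>2)" using assms by auto
  have "\<bar>x * y\<bar> \<le> x\<^sup>2 + y\<^sup>2" for x y :: real
    using sum_squares_bound[of "\<bar>x\<bar>" "\<bar>y\<bar>"] mult_nonneg_nonneg[OF abs_ge_zero abs_ge_zero, of x y]
    unfolding abs_mult power2_abs by linarith
  then show "AE \<omega> in M. norm (X \<omega> * Y \<omega>) \<le> norm ((X \<omega>)\<^sup>2 + (Y \<omega>)\<^sup>2)" by simp
qed simp

definition covariation_error ::
    "(real \<Rightarrow> 'w \<Rightarrow> real ^ 'd) \<Rightarrow> real ^ 'd ^ 'd \<Rightarrow> 'd \<Rightarrow> 'd \<Rightarrow> real \<Rightarrow> real \<Rightarrow> 'w \<Rightarrow> real" where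
  "covariation_error B \<Sigma> i j s t \<omega> =
    (B t \<omega> $ i - B s \<omega> $ i) * (B t \<omega> $ j - B s \<omega> $ j) - (t - s) * \<Sigma> $ i $ j"

text \<open>
  The bound is quadratic in \<open>t - s\<close>, since the fourth moment of a Gaussian is three times the square of
  its variance. Summed over a partition, it is therefore of the order of the mesh.
\<close>

lemma covariation_error_moments:
  fixes B :: "real \<Rightarrow> 'w \<Rightarrow> real ^ 'd"
  assumes bm: "brownian_motion M B \<Sigma>" and st: "0 \<le> s" "s \<le> t"
  shows "integrable M (covariation_error B \<Sigma> i j s t)"
    and "(\<integral>\<omega>. covariation_error B \<Sigma> i j s t \<omega> \<partial>M) = 0"
    and "integrable M (\<lambda>\<omega>. (covariation_error B \<Sigma> i j s t \<omega>)\<^sup>2)"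
    and "(\<integral>\<omega>. (covariation_error B \<Sigma> i j s t \<omega>)\<^sup>2 \<partial>M) \<le> 3 / 2 * ((\<Sigma> $ i $ i)\<^sup>2 + (\<Sigma> $ j $ j)\<^sup>2) * (t - s)\<^sup>2"
proof -
  interpret prob_space M by (rule brownian_motionD(1)[OF bm])
  note mom = brownian_increment_moments[OF bm st]
  define x where "x \<omega> = B t \<omega> $ i - B s \<omega> $ i" for \<omega>
  define y where "y \<omega> = B t \<omega> $ j - B s \<omega> $ j" for \<omega>
  define c where "c = (t - s) * \<Sigma> $ i $ j"
  have Z: "covariation_error B \<Sigma> i j s t \<omega> = x \<omega> * y \<omega> - c" for \<omega>
    by (simp add: covariation_error_def x_def y_def c_def)
  have int: "integrable M (\<lambda>\<omega>. x \<omega> * y \<omega>)" "(\<integral>\<omega>. x \<omega> * y \<omega> \<partial>M) = c"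
    and x4: "integrable M (\<lambda>\<omega>. x \<omega> ^ 4)" "(\<integral>\<omega>. x \<omega> ^ 4 \<partial>M) = 3 * ((t - s) * \<Sigma> $ i $ i)\<^sup>2"
    and y4: "integrable M (\<lambda>\<omega>. y \<omega> ^ 4)" "(\<integral>\<omega>. y \<omega> ^ 4 \<partial>M) = 3 * ((t - s) * \<Sigma> $ j $ j)\<^sup>2"
    and [measurable]: "x \<in> borel_measurable M" "y \<in> borel_measurable M"
    using mom(3,4)[of i j] mom(5,6)[of i] mom(5,6)[of j] mom(1)[of i] mom(1)[of j]
    by (auto simp: x_def[abs_def] y_def[abs_def] c_def dest: borel_measurable_integrable)
  show "integrable M (covariation_error B \<Sigma> i j s t)" "(\<integral>\<omega>. covariation_error B \<Sigma> i j s t \<omega> \<partial>M) = 0"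
    using int by (simp_all add: Z[abs_def] prob_space)
  have xy2: "integrable M (\<lambda>\<omega>. (x \<omega> * y \<omega>)\<^sup>2)"
    using integrable_mult_of_squares[of "\<lambda>\<omega>. (x \<omega>)\<^sup>2" M "\<lambda>\<omega>. (y \<omega>)\<^sup>2"] x4(1) y4(1)
    by (simp add: power_mult_distrib)
  have sq: "(covariation_error B \<Sigma> i j s t \<omega>)\<^sup>2 = (x \<omega> * y \<omega>)\<^sup>2 - 2 * c * (x \<omega> * y \<omega>) + c\<^sup>2" for \<omega>
    by (simp add: Z power2_diff algebra_simps)
  show "integrable M (\<lambda>\<omega>. (covariation_error B \<Sigma> i j s t \<omega>)\<^sup>2)"
    unfolding sq using int(1) xy2 by simp
  have "(\<integral>\<omega>. (covariation_error B \<Sigma> i j s t \<omega>)\<^sup>2 \<partial>M) = (\<integral>\<omega>. (x \<omega> * y \<omega>)\<^sup>2 \<partial>M) - c\<^sup>2"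
    unfolding sq using int xy2 by (simp add: prob_space power2_eq_square)
  also have "\<dots> \<le> (\<integral>\<omega>. (x \<omega> * y \<omega>)\<^sup>2 \<partial>M)" by simp
  also have "\<dots> \<le> (\<integral>\<omega>. (x \<omega> ^ 4 + y \<omega> ^ 4) / 2 \<partial>M)"
  proof (rule integral_mono[OF xy2])
    show "integrable M (\<lambda>\<omega>. (x \<omega> ^ 4 + y \<omega> ^ 4) / 2)" using x4(1) y4(1) by simp
    show "(x \<omega> * y \<omega>)\<^sup>2 \<le> (x \<omega> ^ 4 + y \<omega> ^ 4) / 2" for \<omega>
      using sum_squares_bound[of "(x \<omega>)\<^sup>2" "(y \<omega>)\<^sup>2"] by (simp add: power_mult_distrib)
  qed
  also have "\<dots> = 3 / 2 * ((\<Sigma> $ i $ i)\<^sup>2 + (\<Sigma> $ j $ j)\<^sup>2) * (t - s)\<^sup>2"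
    using x4 y4 by (simp add: power_mult_distrib) (simp add: algebra_simps)
  finally show "(\<integral>\<omega>. (covariation_error B \<Sigma> i j s t \<omega>)\<^sup>2 \<partial>M)
      \<le> 3 / 2 * ((\<Sigma> $ i $ i)\<^sup>2 + (\<Sigma> $ j $ j)\<^sup>2) * (t - s)\<^sup>2" .
qed

text \<open>
  The errors over successive intervals are centred and independent of the past, so the cross terms in
  the square of their sum vanish.
\<close>

lemma covariation_error_sum_second_moment:
  fixes B :: "real \<Rightarrow> 'w \<Rightarrow> real ^ 'd" and i j :: 'd
  assumes bm: "brownian_motion M B \<Sigma>" and p: "is_partition 0 T n \<tau>" and "m \<le> n"
  defines "Z \<equiv> (\<lambda>k. covariation_error B \<Sigma> i j (\<tau> k) (\<tau> (Suc k)))"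
  shows "integrable M (\<lambda>\<omega>. (\<Sum>k<m. Z k \<omega>)\<^sup>2) \<and> (\<integral>\<omega>. (\<Sum>k<m. Z k \<omega>)\<^sup>2 \<partial>M)
      \<le> 3 / 2 * ((\<Sigma> $ i $ i)\<^sup>2 + (\<Sigma> $ j $ j)\<^sup>2) * (\<Sum>k<m. (\<tau> (Suc k) - \<tau> k)\<^sup>2)"
  using \<open>m \<le> n\<close>
proof (induction m)
  case (Suc m)
  interpret prob_space M by (rule brownian_motionD(1)[OF bm])
  have bd: "0 \<le> \<tau> k" "\<tau> k \<le> \<tau> (Suc k)" if "k \<le> m" for k
    using that Suc.prems is_partition_bounds(1)[OF p, of k] p by (auto simp: is_partition_def)
  have le: "\<tau> k \<le> \<tau> m" if "k \<le> m" for k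
    using that Suc.prems is_partition_mono[OF p, of k m] by simp
  note mom = covariation_error_moments[OF bm bd, folded Z_def]
  define S where "S \<omega> = (\<Sum>k<m. Z k \<omega>)" for \<omega>
  have IH: "integrable M (\<lambda>\<omega>. (S \<omega>)\<^sup>2)"
    "(\<integral>\<omega>. (S \<omega>)\<^sup>2 \<partial>M) \<le> 3 / 2 * ((\<Sigma> $ i $ i)\<^sup>2 + (\<Sigma> $ j $ j)\<^sup>2) * (\<Sum>k<m. (\<tau> (Suc k) - \<tau> k)\<^sup>2)"
    using Suc unfolding S_def by auto
  have int: "integrable M (Z k)" "integrable M (\<lambda>\<omega>. (Z k \<omega>)\<^sup>2)" "(\<integral>\<omega>. Z k \<omega> \<partial>M) = 0" if "k \<le> m" for k
    using mom[OF that that] by (auto simp: Z_def)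
  have S: "integrable M S" unfolding S_def[abs_def] using int(1) by auto
  have SF: "S \<in> borel_measurable (natural_filtration M B (\<tau> m))"
  proof -
    have [measurable]: "B (\<tau> k) \<in> borel_measurable (natural_filtration M B (\<tau> m))" if "k \<le> m" for k
      using that bd(1) le by (intro measurable_natural_filtration_process) auto
    show ?thesis unfolding S_def[abs_def] Z_def covariation_error_def
      by (intro borel_measurable_sum borel_measurable_diff borel_measurable_times borel_measurable_const
        measurable_compose[OF _ borel_measurable_nth]) auto
  qed
  define g where "g x = x $ i * x $ j - (\<tau> (Suc m) - \<tau> m) * \<Sigma> $ i $ j" for x :: "real ^ 'd"
  have g: "Z m = (\<lambda>\<omega>. g (B (\<tau> (Suc m)) \<omega> - B (\<tau> m) \<omega>))"
    by (simp add: Z_def g_def covariation_error_def[abs_def])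
  have [measurable]: "g \<in> borel_measurable borel" unfolding g_def[abs_def] by measurable
  have SZ: "integrable M (\<lambda>\<omega>. S \<omega> * Z m \<omega>)" "(\<integral>\<omega>. S \<omega> * Z m \<omega> \<partial>M) = 0"
    using brownian_increment_factorises[OF bm bd[of m] SF S, of g] int[of m] unfolding g by auto
  have sq: "(\<Sum>k<Suc m. Z k \<omega>)\<^sup>2 = (S \<omega>)\<^sup>2 + 2 * (S \<omega> * Z m \<omega>) + (Z m \<omega>)\<^sup>2" for \<omega>
    by (simp add: S_def power2_sum)
  have "(\<integral>\<omega>. (\<Sum>k<Suc m. Z k \<omega>)\<^sup>2 \<partial>M) = (\<integral>\<omega>. (S \<omega>)\<^sup>2 \<partial>M) + (\<integral>\<omega>. (Z m \<omega>)\<^sup>2 \<partial>M)"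
    unfolding sq using IH SZ int(2)[of m] by simp
  also have "\<dots> \<le> 3 / 2 * ((\<Sigma> $ i $ i)\<^sup>2 + (\<Sigma> $ j $ j)\<^sup>2) * (\<Sum>k<Suc m. (\<tau> (Suc k) - \<tau> k)\<^sup>2)"
    using IH(2) mom(4)[of m i j] by (simp add: Z_def distrib_left)
  finally show ?case unfolding sq using IH SZ int(2)[of m] by simp
qed simp

lemma brownian_motion_covariation:
  fixes B :: "real \<Rightarrow> 'w \<Rightarrow> real ^ 'd"
  assumes bm: "brownian_motion M B \<Sigma>" and "0 \<le> T"
  shows "is_covariation M (\<lambda>t \<omega>. B t \<omega> $ i) (\<lambda>t \<omega>. B t \<omega> $ j) T (\<lambda>\<omega>. T * \<Sigma> $ i $ j)"
  unfolding is_covariation_def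
proof (intro conjI allI impI)
  fix e :: real assume "e > 0"
  interpret prob_space M by (rule brownian_motionD(1)[OF bm])
  define K where "K = 3 / 2 * ((\<Sigma> $ i $ i)\<^sup>2 + (\<Sigma> $ j $ j)\<^sup>2) * T"
  have "K \<ge> 0" using assms by (simp add: K_def)
  \<comment> \<open>Chebyshev turns the bound \<open>K * \<delta>\<close> on the second moment into \<open>K * \<delta> / e\<^sup>2\<close>, to be less than \<open>e\<close>.\<close>
  define \<delta> where "\<delta> = e ^ 3 / (K + 1)"
  have "\<delta> > 0" using \<open>e > 0\<close> \<open>K \<ge> 0\<close> by (simp add: \<delta>_def)
  have "measure M {\<omega> \<in> space M. \<bar>(\<Sum>k<n. (B (\<tau> (Suc k)) \<omega> $ i - B (\<tau> k) \<omega> $ i) *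
      (B (\<tau> (Suc k)) \<omega> $ j - B (\<tau> k) \<omega> $ j)) - T * \<Sigma> $ i $ j\<bar> > e} < e"
    if p: "is_partition 0 T n \<tau>" and mesh: "\<forall>k<n. \<tau> (Suc k) - \<tau> k < \<delta>" for n \<tau>
  proof -
    define S where "S \<omega> = (\<Sum>k<n. covariation_error B \<Sigma> i j (\<tau> k) (\<tau> (Suc k)) \<omega>)" for \<omega>
    have tele: "(\<Sum>k<n. \<tau> (Suc k) - \<tau> k) = T"
      using sum_lessThan_telescope[of \<tau> n] p by (simp add: is_partition_def)
    have S: "(\<Sum>k<n. (B (\<tau> (Suc k)) \<omega> $ i - B (\<tau> k) \<omega> $ i) *
      (B (\<tau> (Suc k)) \<omega> $ j - B (\<tau> k) \<omega> $ j)) - T * \<Sigma> $ i $ j = S \<omega>" for \<omega>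
      by (simp only: S_def covariation_error_def sum_subtractf[of "\<lambda>k. _ k * _ k"]
        sum_distrib_right[symmetric] tele)
    have S2: "integrable M (\<lambda>\<omega>. (S \<omega>)\<^sup>2)"
      "(\<integral>\<omega>. (S \<omega>)\<^sup>2 \<partial>M) \<le> 3 / 2 * ((\<Sigma> $ i $ i)\<^sup>2 + (\<Sigma> $ j $ j)\<^sup>2) * (\<Sum>k<n. (\<tau> (Suc k) - \<tau> k)\<^sup>2)"
      using covariation_error_sum_second_moment[OF bm p order_refl] by (auto simp: S_def)
    have "(\<Sum>k<n. (\<tau> (Suc k) - \<tau> k)\<^sup>2) \<le> (\<Sum>k<n. \<delta> * (\<tau> (Suc k) - \<tau> k))"
      unfolding power2_eq_square using mesh p
      by (intro sum_mono mult_right_mono) (auto simp: is_partition_def less_imp_le)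
    also have "\<dots> = \<delta> * T" by (simp add: sum_distrib_left[symmetric] tele)
    finally have mesh2: "(\<Sum>k<n. (\<tau> (Suc k) - \<tau> k)\<^sup>2) \<le> \<delta> * T" .
    have "(\<integral>\<omega>. (S \<omega>)\<^sup>2 \<partial>M) \<le> 3 / 2 * ((\<Sigma> $ i $ i)\<^sup>2 + (\<Sigma> $ j $ j)\<^sup>2) * (\<delta> * T)"
      by (rule order_trans[OF S2(2) mult_left_mono[OF mesh2]]) simp
    also have "\<dots> = K * \<delta>" by (simp add: K_def)
    also have "\<dots> < (K + 1) * \<delta>" using \<open>\<delta> > 0\<close> by simp
    also have "\<dots> = e ^ 3" using \<open>K \<ge> 0\<close> by (simp add: \<delta>_def)
    finally have small: "(\<integral>\<omega>. (S \<omega>)\<^sup>2 \<partial>M) < e ^ 3" .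
    have [measurable]: "S \<in> borel_measurable M"
    proof -
      have "integrable M (covariation_error B \<Sigma> i j (\<tau> k) (\<tau> (Suc k)))" if "k < n" for k
        using that p is_partition_bounds(1)[OF p, of k]
        by (intro covariation_error_moments(1)[OF bm]) (auto simp: is_partition_def)
      then show ?thesis unfolding S_def[abs_def] by (intro borel_measurable_sum) auto
    qed
    have "measure M {\<omega> \<in> space M. \<bar>S \<omega>\<bar> > e} \<le> measure M {\<omega> \<in> space M. \<bar>S \<omega>\<bar> \<ge> e}"
      by (intro finite_measure_mono) auto
    also have "\<dots> \<le> (\<integral>\<omega>. (S \<omega>)\<^sup>2 \<partial>M) / e\<^sup>2"
      using S2 \<open>e > 0\<close> by (intro second_moment_method) auto
    also have "\<dots> < e" using small \<open>e > 0\<close> by (simp add: field_simps power3_eq_cube power2_eq_square)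
    finally show ?thesis unfolding S .
  qed
  then show "\<exists>\<delta>>0. \<forall>n \<tau>. is_partition 0 T n \<tau> \<and> (\<forall>k<n. \<tau> (Suc k) - \<tau> k < \<delta>) \<longrightarrow>
     measure M {\<omega> \<in> space M. \<bar>(\<Sum>k<n. (B (\<tau> (Suc k)) \<omega> $ i - B (\<tau> k) \<omega> $ i) *
      (B (\<tau> (Suc k)) \<omega> $ j - B (\<tau> k) \<omega> $ j)) - T * \<Sigma> $ i $ j\<bar> > e} < e"
    using \<open>\<delta> > 0\<close> by blast
qed simp

text \<open>
  The sum along a single partition that is fine enough for both candidates is close in probability to
  each of them.
\<close>

lemma is_covariation_unique:
  assumes "prob_space M" "0 \<le> T"
    and X: "\<And>t. 0 \<le> t \<Longrightarrow> X t \<in> borel_measurable M" and Y: "\<And>t. 0 \<le> t \<Longrightarrow> Y t \<in> borel_measurable M"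
    and Q: "is_covariation M X Y T Q" and Q': "is_covariation M X Y T Q'"
  shows "AE \<omega> in M. Q \<omega> = Q' \<omega>"
proof -
  interpret prob_space M by fact
  have [measurable]: "Q \<in> borel_measurable M" "Q' \<in> borel_measurable M"
    using Q Q' by (auto simp: is_covariation_def)
  have small: "measure M {\<omega> \<in> space M. \<bar>Q \<omega> - Q' \<omega>\<bar> > 2 * e} \<le> 2 * e" if "e > 0" for e :: real
  proof -
    from Q that obtain \<delta> where "\<delta> > 0" and d: "\<And>n \<tau>. is_partition 0 T n \<tau> \<and> (\<forall>k<n. \<tau> (Suc k) - \<tau> k < \<delta>) \<Longrightarrow>
      measure M {\<omega> \<in> space M. \<bar>(\<Sum>k<n. (X (\<tau> (Suc k)) \<omega> - X (\<tau> k) \<omega>) * (Y (\<tau> (Suc k)) \<omega> - Y (\<tau> k) \<omega>)) - Q \<omega>\<bar> > e} < e"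
      unfolding is_covariation_def by blast
    from Q' that obtain \<delta>' where "\<delta>' > 0" and d': "\<And>n \<tau>. is_partition 0 T n \<tau> \<and> (\<forall>k<n. \<tau> (Suc k) - \<tau> k < \<delta>') \<Longrightarrow>
      measure M {\<omega> \<in> space M. \<bar>(\<Sum>k<n. (X (\<tau> (Suc k)) \<omega> - X (\<tau> k) \<omega>) * (Y (\<tau> (Suc k)) \<omega> - Y (\<tau> k) \<omega>)) - Q' \<omega>\<bar> > e} < e"
      unfolding is_covariation_def by blast
    obtain n \<tau> where p: "is_partition 0 T n \<tau>" and m: "\<And>k. k < n \<Longrightarrow> \<tau> (Suc k) - \<tau> k < min \<delta> \<delta>'"
      using fine_partition_exists[of 0 T "min \<delta> \<delta>'"] \<open>0 \<le> T\<close> \<open>\<delta> > 0\<close> \<open>\<delta>' > 0\<close> by auto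
    define S where "S \<omega> = (\<Sum>k<n. (X (\<tau> (Suc k)) \<omega> - X (\<tau> k) \<omega>) * (Y (\<tau> (Suc k)) \<omega> - Y (\<tau> k) \<omega>))" for \<omega>
    have [measurable]: "S \<in> borel_measurable M"
      unfolding S_def[abs_def] using is_partition_bounds(1)[OF p]
      by (intro borel_measurable_sum borel_measurable_times borel_measurable_diff X Y) auto
    have "measure M {\<omega> \<in> space M. \<bar>Q \<omega> - Q' \<omega>\<bar> > 2 * e}
        \<le> measure M ({\<omega> \<in> space M. \<bar>S \<omega> - Q \<omega>\<bar> > e} \<union> {\<omega> \<in> space M. \<bar>S \<omega> - Q' \<omega>\<bar> > e})"
      by (intro finite_measure_mono) auto
    also have "\<dots> \<le> measure M {\<omega> \<in> space M. \<bar>S \<omega> - Q \<omega>\<bar> > e} + measure M {\<omega> \<in> space M. \<bar>S \<omega> - Q' \<omega>\<bar> > e}"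
      by (intro measure_Un_le) auto
    also have "\<dots> \<le> e + e"
      using d[of n \<tau>] d'[of n \<tau>] p m by (intro add_mono) (auto simp: S_def less_imp_le)
    finally show ?thesis by simp
  qed
  have "AE \<omega> in M. \<bar>Q \<omega> - Q' \<omega>\<bar> \<le> 1 / real (Suc k)" for k
  proof -
    define a where "a = 1 / real (Suc k)"
    have "a > 0" by (simp add: a_def)
    have "measure M {\<omega> \<in> space M. \<bar>Q \<omega> - Q' \<omega>\<bar> > a} \<le> 0"
    proof (rule field_le_epsilon)
      fix e :: real assume "e > 0"
      have "measure M {\<omega> \<in> space M. \<bar>Q \<omega> - Q' \<omega>\<bar> > a} \<le> measure M {\<omega> \<in> space M. \<bar>Q \<omega> - Q' \<omega>\<bar> > 2 * (min a e / 2)}"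
        by (intro finite_measure_mono) auto
      also have "\<dots> \<le> min a e" using small[of "min a e / 2"] \<open>a > 0\<close> \<open>e > 0\<close> by simp
      finally show "measure M {\<omega> \<in> space M. \<bar>Q \<omega> - Q' \<omega>\<bar> > a} \<le> 0 + e" by simp
    qed
    then have "measure M {\<omega> \<in> space M. \<bar>Q \<omega> - Q' \<omega>\<bar> > a} = 0"
      using measure_nonneg by (intro antisym) auto
    then have "AE \<omega> in M. \<not> \<bar>Q \<omega> - Q' \<omega>\<bar> > a"
      by (subst (asm) prob_eq_0) auto
    then show ?thesis by (simp add: a_def not_less)
  qed
  then have "AE \<omega> in M. \<forall>k. \<bar>Q \<omega> - Q' \<omega>\<bar> \<le> 1 / real (Suc k)" by (simp add: AE_all_countable)
  then show ?thesis
  proof (eventually_elim)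
    case (elim \<omega>)
    have "\<bar>Q \<omega> - Q' \<omega>\<bar> \<le> 0"
      using elim by (intro LIMSEQ_le_const[OF LIMSEQ_inverse_real_of_nat]) (auto simp: inverse_eq_divide)
    then show ?case by simp
  qed
qed

section \<open>The Ito isometry and uniqueness of the Ito integral\<close>

lemma brownian_increment_orthogonal:
  fixes B :: "real \<Rightarrow> 'w \<Rightarrow> real ^ 'd"
  assumes bm: "brownian_motion M B \<Sigma>" and st: "0 \<le> s" "s \<le> t"
    and G: "G \<in> borel_measurable (natural_filtration M B s)" "integrable M G"
  shows "integrable M (\<lambda>\<omega>. G \<omega> * (B t \<omega> $ j - B s \<omega> $ j))"
    and "(\<integral>\<omega>. G \<omega> * (B t \<omega> $ j - B s \<omega> $ j) \<partial>M) = 0"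
    and "integrable M (\<lambda>\<omega>. G \<omega> * (B t \<omega> $ j - B s \<omega> $ j)\<^sup>2)"
    and "(\<integral>\<omega>. G \<omega> * (B t \<omega> $ j - B s \<omega> $ j)\<^sup>2 \<partial>M) = (t - s) * \<Sigma> $ j $ j * (\<integral>\<omega>. G \<omega> \<partial>M)"
  using brownian_increment_factorises[OF bm st G, of "\<lambda>x. x $ j"]
    brownian_increment_factorises[OF bm st G, of "\<lambda>x. (x $ j)\<^sup>2"]
    brownian_increment_moments(1,2)[OF bm st, of j] brownian_increment_moments(3,4)[OF bm st, of j j]
  by (simp_all add: power2_eq_square)

lemma integrable_bounded_mult:
  fixes H f :: "'w \<Rightarrow> real"
  assumes "H \<in> borel_measurable M" "bounded (H ` space M)" "integrable M f"
  shows "integrable M (\<lambda>\<omega>. H \<omega> * f \<omega>)"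
proof -
  from assms(2) obtain K where K: "\<And>\<omega>. \<omega> \<in> space M \<Longrightarrow> \<bar>H \<omega>\<bar> \<le> K"
    unfolding bounded_iff by auto
  have "AE \<omega> in M. \<bar>H \<omega> * f \<omega>\<bar> \<le> \<bar>K * f \<omega>\<bar>"
  proof (rule AE_I2)
    fix \<omega> assume "\<omega> \<in> space M"
    from K[OF this] have "\<bar>H \<omega>\<bar> \<le> \<bar>K\<bar>" by linarith
    then show "\<bar>H \<omega> * f \<omega>\<bar> \<le> \<bar>K * f \<omega>\<bar>" by (simp add: abs_mult mult_right_mono)
  qed
  then show ?thesis
    using assms(1,3)
    by (intro Bochner_Integration.integrable_bound[OF integrable_mult_right[OF assms(3), of K]]) auto
qed

text \<open>
  The part of \<open>(a, b]\<close> before \<open>c\<close> belongs to the past of the increment over \<open>(c, d]\<close> and contributes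
  nothing. On the overlap the squared increment is replaced by its mean. The remaining increment, of
  whichever interval ends later, is in turn independent of all that precedes it.
\<close>

lemma elementary_terms_covariance_ordered:
  fixes B :: "real \<Rightarrow> 'w \<Rightarrow> real ^ 'd"
  assumes bm: "brownian_motion M B \<Sigma>" and le: "0 \<le> a" "a \<le> b" "c \<le> d" "a \<le> c"
    and H: "H \<in> borel_measurable (natural_filtration M B a)" "bounded (H ` space M)"
    and H': "H' \<in> borel_measurable (natural_filtration M B c)" "bounded (H' ` space M)"
  shows "integrable M (\<lambda>\<omega>. H \<omega> * (B b \<omega> $ j - B a \<omega> $ j) * (H' \<omega> * (B d \<omega> $ j - B c \<omega> $ j)))"
    and "(\<integral>\<omega>. H \<omega> * (B b \<omega> $ j - B a \<omega> $ j) * (H' \<omega> * (B d \<omega> $ j - B c \<omega> $ j)) \<partial>M)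
      = \<Sigma> $ j $ j * (\<integral>\<omega>. H \<omega> * H' \<omega> \<partial>M) * max 0 (min b d - max a c)"
proof -
  interpret prob_space M by (rule brownian_motionD(1)[OF bm])
  define W where "W t \<omega> = B t \<omega> $ j" for t \<omega>
  have FM: "f \<in> borel_measurable M" if "f \<in> borel_measurable (natural_filtration M B t)" for f :: "'w \<Rightarrow> real" and t
    using measurable_from_natural_filtration[OF brownian_motionD(2)[OF bm] that] .
  have HF: "H \<in> borel_measurable (natural_filtration M B t)" if "a \<le> t" for t
    using H(1) that by (rule measurable_natural_filtration_mono)
  have HF': "H' \<in> borel_measurable (natural_filtration M B t)" if "c \<le> t" for t
    using H'(1) that by (rule measurable_natural_filtration_mono)
  have WF: "(\<lambda>\<omega>. W u \<omega> - W v \<omega>) \<in> borel_measurable (natural_filtration M B t)"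
    if "0 \<le> u" "u \<le> t" "0 \<le> v" "v \<le> t" for u v t
    unfolding W_def using that
    by (intro borel_measurable_diff measurable_compose[OF _ borel_measurable_nth]
        measurable_natural_filtration_process)
  have HH: "integrable M (\<lambda>\<omega>. H \<omega> * (H' \<omega> * f \<omega>))" if "integrable M f" for f
    using that H(2) H'(2) FM[OF H(1)] FM[OF H'(1)] by (intro integrable_bounded_mult)
  have Wint: "integrable M (\<lambda>\<omega>. W u \<omega> - W v \<omega>)" if "0 \<le> v" "v \<le> u" for u v
    using brownian_increment_moments(1)[OF bm that, of j] by (simp add: W_def)
  \<comment> \<open>A product of \<open>H H'\<close> with an increment up to \<open>u\<close> is uncorrelated with an increment after \<open>u\<close>.\<close>
  have past: "integrable M (\<lambda>\<omega>. H \<omega> * (H' \<omega> * (W u \<omega> - W v \<omega>)) * (W r \<omega> - W u \<omega>))"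
    "(\<integral>\<omega>. H \<omega> * (H' \<omega> * (W u \<omega> - W v \<omega>)) * (W r \<omega> - W u \<omega>) \<partial>M) = 0"
    if "0 \<le> v" "v \<le> u" "u \<le> r" "c \<le> u" for u v r
  proof -
    have "(\<lambda>\<omega>. H \<omega> * (H' \<omega> * (W u \<omega> - W v \<omega>))) \<in> borel_measurable (natural_filtration M B u)"
      using that le by (intro borel_measurable_times HF HF' WF) auto
    from brownian_increment_orthogonal(1,2)[OF bm _ _ this HH[OF Wint]] that
    show "integrable M (\<lambda>\<omega>. H \<omega> * (H' \<omega> * (W u \<omega> - W v \<omega>)) * (W r \<omega> - W u \<omega>))"
      "(\<integral>\<omega>. H \<omega> * (H' \<omega> * (W u \<omega> - W v \<omega>)) * (W r \<omega> - W u \<omega>) \<partial>M) = 0"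
      unfolding W_def by auto
  qed
  have "integrable M (\<lambda>\<omega>. H \<omega> * (W b \<omega> - W a \<omega>) * (H' \<omega> * (W d \<omega> - W c \<omega>))) \<and>
    (\<integral>\<omega>. H \<omega> * (W b \<omega> - W a \<omega>) * (H' \<omega> * (W d \<omega> - W c \<omega>)) \<partial>M)
      = \<Sigma> $ j $ j * (\<integral>\<omega>. H \<omega> * H' \<omega> \<partial>M) * max 0 (min b d - max a c)"
  proof (cases "b \<le> c")
    case True
    have "(\<lambda>\<omega>. H \<omega> * (H' \<omega> * (W b \<omega> - W a \<omega>))) \<in> borel_measurable (natural_filtration M B c)"
      using le True by (intro borel_measurable_times HF HF' WF) auto
    from brownian_increment_orthogonal(1,2)[OF bm _ le(3) this HH[OF Wint], of j] le True
    show ?thesis unfolding W_def by (simp add: mult_ac max_def min_def)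
  next
    case False
    define m where "m = min b d"
    define p where "p = max b d"
    have mp: "c \<le> m" "m \<le> p" "0 \<le> c" "0 \<le> m" using le False by (auto simp: m_def p_def)
    have GF: "(\<lambda>\<omega>. H \<omega> * H' \<omega>) \<in> borel_measurable (natural_filtration M B c)"
      using le by (intro borel_measurable_times HF HF') auto
    have Gint: "integrable M (\<lambda>\<omega>. H \<omega> * H' \<omega>)" using HH[of "\<lambda>_. 1"] by simp
    note sq = brownian_increment_orthogonal(3,4)[OF bm mp(3,1) GF Gint, of j, folded W_def]
    note past1 = past[of a c d, OF le(1,4,3) order_refl]
    note past2 = past[of c m p, OF mp(3,1,2,1)]
    \<comment> \<open>\<open>b\<close> and \<open>d\<close> are \<open>m\<close> and \<open>p\<close> in some order, so this holds whichever interval ends first.\<close>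
    have split: "H \<omega> * (W b \<omega> - W a \<omega>) * (H' \<omega> * (W d \<omega> - W c \<omega>))
      = H \<omega> * (H' \<omega> * (W c \<omega> - W a \<omega>)) * (W d \<omega> - W c \<omega>)
        + H \<omega> * H' \<omega> * (W m \<omega> - W c \<omega>)\<^sup>2
        + H \<omega> * (H' \<omega> * (W m \<omega> - W c \<omega>)) * (W p \<omega> - W m \<omega>)" for \<omega>
      by (cases "b \<le> d") (simp_all add: m_def p_def power2_eq_square algebra_simps)
    have "max 0 (min b d - max a c) = m - c" using le mp by (simp add: m_def)
    then show ?thesis unfolding split using sq past1 past2 by simp
  qed
  then show "integrable M (\<lambda>\<omega>. H \<omega> * (B b \<omega> $ j - B a \<omega> $ j) * (H' \<omega> * (B d \<omega> $ j - B c \<omega> $ j)))"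
    "(\<integral>\<omega>. H \<omega> * (B b \<omega> $ j - B a \<omega> $ j) * (H' \<omega> * (B d \<omega> $ j - B c \<omega> $ j)) \<partial>M)
      = \<Sigma> $ j $ j * (\<integral>\<omega>. H \<omega> * H' \<omega> \<partial>M) * max 0 (min b d - max a c)"
    by (simp_all add: W_def)
qed

lemma elementary_terms_covariance:
  fixes B :: "real \<Rightarrow> 'w \<Rightarrow> real ^ 'd"
  assumes bm: "brownian_motion M B \<Sigma>" and le: "0 \<le> a" "a \<le> b" "0 \<le> c" "c \<le> d"
    and H: "H \<in> borel_measurable (natural_filtration M B a)" "bounded (H ` space M)"
    and H': "H' \<in> borel_measurable (natural_filtration M B c)" "bounded (H' ` space M)"
  shows "integrable M (\<lambda>\<omega>. H \<omega> * (B b \<omega> $ j - B a \<omega> $ j) * (H' \<omega> * (B d \<omega> $ j - B c \<omega> $ j)))"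
    and "(\<integral>\<omega>. H \<omega> * (B b \<omega> $ j - B a \<omega> $ j) * (H' \<omega> * (B d \<omega> $ j - B c \<omega> $ j)) \<partial>M)
      = \<Sigma> $ j $ j * (\<integral>\<omega>. H \<omega> * H' \<omega> \<partial>M) * max 0 (min b d - max a c)"
proof -
  have "integrable M (\<lambda>\<omega>. H \<omega> * (B b \<omega> $ j - B a \<omega> $ j) * (H' \<omega> * (B d \<omega> $ j - B c \<omega> $ j))) \<and>
    (\<integral>\<omega>. H \<omega> * (B b \<omega> $ j - B a \<omega> $ j) * (H' \<omega> * (B d \<omega> $ j - B c \<omega> $ j)) \<partial>M)
      = \<Sigma> $ j $ j * (\<integral>\<omega>. H \<omega> * H' \<omega> \<partial>M) * max 0 (min b d - max a c)"
  proof (cases "a \<le> c")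
    case True
    then show ?thesis using elementary_terms_covariance_ordered[OF bm le(1,2,4) _ H H', of j] by blast
  next
    case False
    then have "c \<le> a" by simp
    have swap: "H \<omega> * (B b \<omega> $ j - B a \<omega> $ j) * (H' \<omega> * (B d \<omega> $ j - B c \<omega> $ j))
      = H' \<omega> * (B d \<omega> $ j - B c \<omega> $ j) * (H \<omega> * (B b \<omega> $ j - B a \<omega> $ j))"
      "H \<omega> * H' \<omega> = H' \<omega> * H \<omega>" for \<omega> by (simp_all only: mult.commute)
    show ?thesis
      using elementary_terms_covariance_ordered[OF bm le(3,4,2) \<open>c \<le> a\<close> H' H, of j]
      unfolding swap min.commute[of b d] max.commute[of a c] by blast
  qed
  then show "integrable M (\<lambda>\<omega>. H \<omega> * (B b \<omega> $ j - B a \<omega> $ j) * (H' \<omega> * (B d \<omega> $ j - B c \<omega> $ j)))"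
    "(\<integral>\<omega>. H \<omega> * (B b \<omega> $ j - B a \<omega> $ j) * (H' \<omega> * (B d \<omega> $ j - B c \<omega> $ j)) \<partial>M)
      = \<Sigma> $ j $ j * (\<integral>\<omega>. H \<omega> * H' \<omega> \<partial>M) * max 0 (min b d - max a c)"
    by blast+
qed

text \<open>
  The intervals may overlap in any way. This makes the isometry applicable to the difference of two
  elementary integrals along different partitions, without a common refinement: both sides are
  quadratic forms in the \<open>H k\<close>, and their coefficients agree by \<open>elementary_terms_covariance\<close>.
\<close>

lemma ito_isometry:
  fixes B :: "real \<Rightarrow> 'w \<Rightarrow> real ^ 'd"
  assumes bm: "brownian_motion M B \<Sigma>" and K: "finite K"
    and le: "\<And>k. k \<in> K \<Longrightarrow> 0 \<le> a k \<and> a k \<le> b k"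
    and H: "\<And>k. k \<in> K \<Longrightarrow> H k \<in> borel_measurable (natural_filtration M B (a k)) \<and> bounded (H k ` space M)"
  shows "(\<integral>\<^sup>+\<omega>. ennreal ((\<Sum>k\<in>K. H k \<omega> * (B (b k) \<omega> $ j - B (a k) \<omega> $ j))\<^sup>2) \<partial>M)
    = ennreal (\<Sigma> $ j $ j) *
      (\<integral>\<^sup>+\<omega>. (\<integral>\<^sup>+s. ennreal ((\<Sum>k\<in>K. H k \<omega> * indicator {a k<..b k} s)\<^sup>2) \<partial>lborel) \<partial>M)"
proof -
  interpret prob_space M by (rule brownian_motionD(1)[OF bm])
  define len where "len k l = max 0 (min (b k) (b l) - max (a k) (a l))" for k l
  have v: "0 \<le> \<Sigma> $ j $ j"
  proof -
    have "0 \<le> (\<integral>\<omega>. (B 1 \<omega> - B 0 \<omega>) $ j * (B 1 \<omega> - B 0 \<omega>) $ j \<partial>M)"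
      by (intro Bochner_Integration.integral_nonneg) simp
    also have "\<dots> = \<Sigma> $ j $ j" using brownian_increment_moments(4)[OF bm, of 0 1 j j] by simp
    finally show ?thesis .
  qed
  have HM: "H k \<in> borel_measurable M" if "k \<in> K" for k
    using H[OF that] by (intro measurable_from_natural_filtration[OF brownian_motionD(2)[OF bm], where t="a k"]) auto
  have HH: "integrable M (\<lambda>\<omega>. H k \<omega> * H l \<omega>)" if "k \<in> K" "l \<in> K" for k l
    using that HM H integrable_bounded_mult[of "H k" M "H l"] integrable_bounded_mult[of "H l" M "\<lambda>_. 1"] by auto
  note cov = elementary_terms_covariance[OF bm]
  have sq: "(\<Sum>k\<in>K. f k)\<^sup>2 = (\<Sum>k\<in>K. \<Sum>l\<in>K. f k * f l)" for f :: "_ \<Rightarrow> real"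
    by (simp add: power2_eq_square sum_product)
  define R where "R = (\<Sum>k\<in>K. \<Sum>l\<in>K. (\<integral>\<omega>. H k \<omega> * H l \<omega> \<partial>M) * len k l)"
  have "integrable M (\<lambda>\<omega>. (\<Sum>k\<in>K. H k \<omega> * (B (b k) \<omega> $ j - B (a k) \<omega> $ j))\<^sup>2)"
    unfolding sq using le H by (intro Bochner_Integration.integrable_sum cov(1)) auto
  moreover have "(\<integral>\<omega>. (\<Sum>k\<in>K. H k \<omega> * (B (b k) \<omega> $ j - B (a k) \<omega> $ j))\<^sup>2 \<partial>M) = \<Sigma> $ j $ j * R"
  proof -
    have "(\<integral>\<omega>. (\<Sum>k\<in>K. H k \<omega> * (B (b k) \<omega> $ j - B (a k) \<omega> $ j))\<^sup>2 \<partial>M)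
      = (\<Sum>k\<in>K. \<Sum>l\<in>K. (\<integral>\<omega>. H k \<omega> * (B (b k) \<omega> $ j - B (a k) \<omega> $ j) * (H l \<omega> * (B (b l) \<omega> $ j - B (a l) \<omega> $ j)) \<partial>M))"
      unfolding sq using le H
      by (subst Bochner_Integration.integral_sum, intro Bochner_Integration.integrable_sum cov(1), auto intro!: sum.cong Bochner_Integration.integral_sum cov(1))
    also have "\<dots> = (\<Sum>k\<in>K. \<Sum>l\<in>K. \<Sigma> $ j $ j * (\<integral>\<omega>. H k \<omega> * H l \<omega> \<partial>M) * len k l)"
      unfolding len_def using le H by (intro sum.cong refl cov(2)) auto
    finally show ?thesis by (simp add: R_def sum_distrib_left mult.assoc)
  qed
  ultimately have lhs: "(\<integral>\<^sup>+\<omega>. ennreal ((\<Sum>k\<in>K. H k \<omega> * (B (b k) \<omega> $ j - B (a k) \<omega> $ j))\<^sup>2) \<partial>M) = ennreal (\<Sigma> $ j $ j * R)"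
    by (subst nn_integral_eq_integral) auto
  have inner: "integrable lborel (\<lambda>s. (\<Sum>k\<in>K. H k \<omega> * indicator {a k<..b k} s)\<^sup>2)"
    "(\<integral>s. (\<Sum>k\<in>K. H k \<omega> * indicator {a k<..b k} s)\<^sup>2 \<partial>lborel) = (\<Sum>k\<in>K. \<Sum>l\<in>K. H k \<omega> * H l \<omega> * len k l)" for \<omega>
  proof -
    have eq: "H k \<omega> * indicator {a k<..b k} s * (H l \<omega> * indicator {a l<..b l} s)
      = H k \<omega> * H l \<omega> * indicator {max (a k) (a l)<..min (b k) (b l)} s" for k l s
      by (auto simp: indicator_def)
    have hb: "has_bochner_integral lborel (\<lambda>s. H k \<omega> * H l \<omega> * indicator {max (a k) (a l)<..min (b k) (b l)} s)
      (H k \<omega> * H l \<omega> * len k l)" for k l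
    proof -
      have "has_bochner_integral lborel (indicator {max (a k) (a l)<..min (b k) (b l)} :: real \<Rightarrow> real) (len k l)"
        using has_bochner_integral_real_indicator[of "{max (a k) (a l)<..min (b k) (b l)}" lborel]
        by (cases "max (a k) (a l) \<le> min (b k) (b l)") (auto simp: len_def max_def)
      then show ?thesis by (rule has_bochner_integral_mult_right) 
    qed
    show "integrable lborel (\<lambda>s. (\<Sum>k\<in>K. H k \<omega> * indicator {a k<..b k} s)\<^sup>2)"
      "(\<integral>s. (\<Sum>k\<in>K. H k \<omega> * indicator {a k<..b k} s)\<^sup>2 \<partial>lborel) = (\<Sum>k\<in>K. \<Sum>l\<in>K. H k \<omega> * H l \<omega> * len k l)"
      using has_bochner_integral_sum[of K lborel "\<lambda>k s. \<Sum>l\<in>K. H k \<omega> * H l \<omega> * indicator {max (a k) (a l)<..min (b k) (b l)} s", OF has_bochner_integral_sum, OF hb]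
      unfolding sq eq by (auto simp: has_bochner_integral_iff)
  qed
  have "(\<integral>\<^sup>+\<omega>. (\<integral>\<^sup>+s. ennreal ((\<Sum>k\<in>K. H k \<omega> * indicator {a k<..b k} s)\<^sup>2) \<partial>lborel) \<partial>M)
    = (\<integral>\<^sup>+\<omega>. ennreal (\<Sum>k\<in>K. \<Sum>l\<in>K. H k \<omega> * H l \<omega> * len k l) \<partial>M)"
    by (intro nn_integral_cong, subst nn_integral_eq_integral[OF inner(1)]) (auto simp: inner(2))
  also have "\<dots> = ennreal R"
  proof (subst nn_integral_eq_integral)
    show "integrable M (\<lambda>\<omega>. \<Sum>k\<in>K. \<Sum>l\<in>K. H k \<omega> * H l \<omega> * len k l)"
      using HH by (intro Bochner_Integration.integrable_sum integrable_mult_left) auto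
    have "0 \<le> (\<Sum>k\<in>K. \<Sum>l\<in>K. H k \<omega> * H l \<omega> * len k l)" for \<omega>
      unfolding inner(2)[symmetric] by (intro integral_nonneg_AE) auto
    then show "AE \<omega> in M. 0 \<le> (\<Sum>k\<in>K. \<Sum>l\<in>K. H k \<omega> * H l \<omega> * len k l)" by auto
    have "(\<integral>\<omega>. (\<Sum>k\<in>K. \<Sum>l\<in>K. H k \<omega> * H l \<omega> * len k l) \<partial>M) = R"
      unfolding R_def using HH
      by (subst Bochner_Integration.integral_sum, intro Bochner_Integration.integrable_sum integrable_mult_left, auto intro!: sum.cong simp: Bochner_Integration.integral_sum)
    then show "ennreal (\<integral>\<omega>. (\<Sum>k\<in>K. \<Sum>l\<in>K. H k \<omega> * H l \<omega> * len k l) \<partial>M) = ennreal R" by simp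
  qed
  finally show ?thesis using lhs v by (simp add: ennreal_mult')
qed

lemma elementary_integrandD:
  assumes "elementary_integrand M F T n \<tau> H" "k < n"
  shows "0 \<le> \<tau> k" "\<tau> k \<le> \<tau> (Suc k)" "\<tau> (Suc k) \<le> T"
    and "H k \<in> borel_measurable (F (\<tau> k))" "bounded (H k ` space M)"
  using assms is_partition_bounds(1)[of 0 T n \<tau> k] is_partition_bounds(2)[of 0 T n \<tau> "Suc k"]
  by (auto simp: elementary_integrand_def is_partition_def)

lemma elementary_integral_brownian:
  fixes B :: "real \<Rightarrow> 'w \<Rightarrow> real ^ 'd"
  assumes bm: "brownian_motion M B \<Sigma>"
    and el: "elementary_integrand M (natural_filtration M B) T n \<tau> H"
  shows "integrable M (elementary_integral n \<tau> H (\<lambda>t \<omega>. B t \<omega> $ j))"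
    and "(\<integral>\<omega>. elementary_integral n \<tau> H (\<lambda>t \<omega>. B t \<omega> $ j) \<omega> \<partial>M) = 0"
proof -
  interpret prob_space M by (rule brownian_motionD(1)[OF bm])
  have "integrable M (\<lambda>\<omega>. H k \<omega> * (B (\<tau> (Suc k)) \<omega> $ j - B (\<tau> k) \<omega> $ j)) \<and>
    (\<integral>\<omega>. H k \<omega> * (B (\<tau> (Suc k)) \<omega> $ j - B (\<tau> k) \<omega> $ j) \<partial>M) = 0" if "k < n" for k
  proof -
    note D = elementary_integrandD[OF el that]
    have "H k \<in> borel_measurable M"
      using D(4) by (intro measurable_from_natural_filtration[OF brownian_motionD(2)[OF bm], where t="\<tau> k"])
    then have "integrable M (H k)"
      using integrable_bounded_mult[of "H k" M "\<lambda>_. 1"] D(5) by simp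
    then show ?thesis using brownian_increment_orthogonal(1,2)[OF bm D(1,2,4)] by blast
  qed
  then show "integrable M (elementary_integral n \<tau> H (\<lambda>t \<omega>. B t \<omega> $ j))"
    "(\<integral>\<omega>. elementary_integral n \<tau> H (\<lambda>t \<omega>. B t \<omega> $ j) \<omega> \<partial>M) = 0"
    unfolding elementary_integral_def[abs_def] by (auto simp: Bochner_Integration.integral_sum)
qed

text \<open>
  Elementary integrals are centred, and \<open>(E I)\<^sup>2\<close> is at most the second moment of their distance
  from \<open>I\<close>.
\<close>

lemma ito_integral_expectation:
  fixes B :: "real \<Rightarrow> 'w \<Rightarrow> real ^ 'd"
  assumes bm: "brownian_motion M B \<Sigma>"
    and I: "is_ito_integral M (natural_filtration M B) X (\<lambda>t \<omega>. B t \<omega> $ j) T I" "integrable M I"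
  shows "(\<integral>\<omega>. I \<omega> \<partial>M) = 0"
proof -
  interpret prob_space M by (rule brownian_motionD(1)[OF bm])
  from I(1) obtain n \<tau> H where
    el: "\<And>m. elementary_integrand M (natural_filtration M B) T (n m) (\<tau> m) (H m)"
    and lim: "(\<lambda>m. \<integral>\<^sup>+\<omega>. ennreal ((elementary_integral (n m) (\<tau> m) (H m) (\<lambda>t \<omega>. B t \<omega> $ j) \<omega> - I \<omega>)\<^sup>2) \<partial>M) \<longlonglongrightarrow> 0"
    unfolding is_ito_integral_def by blast
  have "ennreal ((expectation I)\<^sup>2) \<le>
    (\<integral>\<^sup>+\<omega>. ennreal ((elementary_integral (n m) (\<tau> m) (H m) (\<lambda>t \<omega>. B t \<omega> $ j) \<omega> - I \<omega>)\<^sup>2) \<partial>M)" for m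
  proof -
    define D where "D \<omega> = elementary_integral (n m) (\<tau> m) (H m) (\<lambda>t \<omega>. B t \<omega> $ j) \<omega> - I \<omega>" for \<omega>
    have D: "integrable M D" "expectation D = - expectation I"
      unfolding D_def[abs_def] using elementary_integral_brownian[OF bm el, of m j] I(2) by auto
    have "ennreal ((expectation I)\<^sup>2) \<le> (\<integral>\<^sup>+\<omega>. ennreal ((D \<omega>)\<^sup>2) \<partial>M)"
    proof (cases "(\<integral>\<^sup>+\<omega>. ennreal ((D \<omega>)\<^sup>2) \<partial>M) < \<infinity>")
      case True
      then have int: "integrable M (\<lambda>\<omega>. (D \<omega>)\<^sup>2)"
        using D(1) by (intro integrableI_nonneg) auto
      have "(expectation I)\<^sup>2 \<le> expectation (\<lambda>\<omega>. (D \<omega>)\<^sup>2)"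
        using variance_eq[OF D(1) int] variance_positive[of D] D(2) by simp
      then show ?thesis
        using int by (subst nn_integral_eq_integral) (auto intro: ennreal_leI)
    qed (simp add: not_less top_unique)
    then show ?thesis by (simp add: D_def)
  qed
  then have "ennreal ((expectation I)\<^sup>2) \<le> 0"
    by (intro LIMSEQ_le_const[OF lim]) auto
  then show ?thesis by simp
qed

text \<open>
  A continuous process is the limit of processes that are constant on cells of length \<open>1 / (n + 1)\<close> in time, each
  of which is jointly measurable because it takes only countably many time points.
\<close>

lemma measurable_continuous_process:
  fixes Y :: "real \<Rightarrow> 'w \<Rightarrow> real"
  assumes Y: "\<And>s. Y s \<in> borel_measurable M"
    and cont: "\<And>\<omega>. \<omega> \<in> space M \<Longrightarrow> continuous_on UNIV (\<lambda>s. Y s \<omega>)"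
  shows "(\<lambda>(\<omega>, s). Y s \<omega>) \<in> borel_measurable (M \<Otimes>\<^sub>M lborel)"
proof -
  define r where "r n s = real_of_int \<lfloor>real (Suc n) * s\<rfloor> / real (Suc n)" for n and s :: real
  have r: "(\<lambda>n. r n s) \<longlonglongrightarrow> s" for s
  proof (rule LIMSEQ_I)
    fix e :: real assume "e > 0"
    then obtain N where N: "1 / real (Suc N) < e" using nat_approx_posE by blast
    have "norm (r n s - s) < e" if "n \<ge> N" for n
    proof -
      have "r n s \<le> s" "s < r n s + 1 / real (Suc n)"
        unfolding r_def by (simp_all add: field_simps) linarith+
      moreover have "1 / real (Suc n) \<le> 1 / real (Suc N)" using that by (simp add: frac_le)
      ultimately show ?thesis using N by simp
    qed
    then show "\<exists>N. \<forall>n\<ge>N. norm (r n s - s) < e" by blast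
  qed
  have lim: "(\<lambda>n. case x of (\<omega>, s) \<Rightarrow> Y (r n s) \<omega>) \<longlonglongrightarrow> (case x of (\<omega>, s) \<Rightarrow> Y s \<omega>)"
    if "x \<in> space (M \<Otimes>\<^sub>M lborel)" for x
  proof -
    have "isCont (\<lambda>s. Y s (fst x)) (snd x)"
      using cont[of "fst x"] that by (auto simp: space_pair_measure continuous_on_eq_continuous_at)
    from isCont_tendsto_compose[OF this r] show ?thesis by (simp add: split_beta)
  qed
  have meas: "(\<lambda>(\<omega>, s). Y (r n s) \<omega>) \<in> borel_measurable (M \<Otimes>\<^sub>M lborel)" for n
  proof -
    have "(\<lambda>x. (\<lambda>(i :: int) x. Y (real_of_int i / real (Suc n)) (fst x)) \<lfloor>real (Suc n) * snd x\<rfloor> x)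
      \<in> borel_measurable (M \<Otimes>\<^sub>M lborel)"
    proof (rule measurable_compose_countable[where f="\<lambda>i x. Y (real_of_int i / real (Suc n)) (fst x)"
          and g="\<lambda>x. \<lfloor>real (Suc n) * snd x\<rfloor>"])
      show "(\<lambda>x. Y (real_of_int i / real (Suc n)) (fst x)) \<in> borel_measurable (M \<Otimes>\<^sub>M lborel)" for i
        by (rule measurable_compose[OF measurable_fst Y])
    qed measurable
    then show ?thesis by (simp add: r_def split_beta)
  qed
  show ?thesis
    by (rule borel_measurable_LIMSEQ_real[where u="\<lambda>n (\<omega>, s). Y (r n s) \<omega>", OF lim meas])
qed

text \<open>
  Subadditivity of the nonnegative integral rests on measurability of the integrands. Paths of \<open>B\<close> are continuous only
  up to a null set, so \<open>B\<close> itself need not be jointly measurable, and the triangle inequality in the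
  \<open>L\<^sup>2\<close> space of the product measure has to be used for a jointly measurable version instead.
\<close>

lemma brownian_motion_jointly_measurable_version:
  fixes B :: "real \<Rightarrow> 'w \<Rightarrow> real ^ 'd"
  assumes bm: "brownian_motion M B \<Sigma>"
  obtains Y where "(\<lambda>(\<omega>, s). Y s \<omega>) \<in> borel_measurable (M \<Otimes>\<^sub>M lborel)"
    and "AE \<omega> in M. \<forall>s\<ge>0. Y s \<omega> = B s \<omega> $ i"
proof -
  from AE_E[OF brownian_motionD(4)[OF bm]] obtain N where
    N: "{\<omega> \<in> space M. \<not> continuous_on {0..} (\<lambda>t. B t \<omega>)} \<subseteq> N" "emeasure M N = 0" "N \<in> sets M" by auto
  define Y where "Y s \<omega> = (if \<omega> \<in> N then 0 else B (max 0 s) \<omega> $ i)" for s \<omega>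
  have "(\<lambda>(\<omega>, s). Y s \<omega>) \<in> borel_measurable (M \<Otimes>\<^sub>M lborel)"
  proof (rule measurable_continuous_process)
    note [measurable] = N(3)
    have [measurable]: "(\<lambda>\<omega>. B (max 0 s) \<omega> $ i) \<in> borel_measurable M" for s
      by (rule measurable_compose[OF brownian_motionD(2)[OF bm] borel_measurable_nth]) simp
    show "Y s \<in> borel_measurable M" for s unfolding Y_def[abs_def] by measurable
    fix \<omega> assume w: "\<omega> \<in> space M"
    show "continuous_on UNIV (\<lambda>s. Y s \<omega>)"
    proof (cases "\<omega> \<in> N")
      case False
      then have "continuous_on {0..} (\<lambda>t. B t \<omega>)" using N(1) w by auto
      then have "continuous_on UNIV (\<lambda>s. B (max 0 s) \<omega>)"
        by (rule continuous_on_compose2) (auto intro!: continuous_intros)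
      then show ?thesis using False by (auto simp: Y_def intro!: continuous_intros)
    qed (simp add: Y_def)
  qed
  moreover have "AE \<omega> in M. \<forall>s\<ge>0. Y s \<omega> = B s \<omega> $ i"
    using N by (intro AE_I[of _ _ N]) (auto simp: Y_def)
  ultimately show ?thesis by (rule that)
qed

text \<open>
  Two sequences of elementary integrands with the same \<open>L\<^sup>2\<close> limit approach each other, and by the
  isometry so do their integrals. The process \<open>Y\<close> is the jointly measurable version of the integrand.
\<close>

lemma ito_integral_unique_of_measurable_version:
  fixes B :: "real \<Rightarrow> 'w \<Rightarrow> real ^ 'd"
  assumes bm: "brownian_motion M B \<Sigma>"
    and Y: "(\<lambda>(\<omega>, s). Y s \<omega>) \<in> borel_measurable (M \<Otimes>\<^sub>M lborel)"
    and XY: "AE \<omega> in M. \<forall>s\<ge>0. Y s \<omega> = X s \<omega>"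
    and I: "is_ito_integral M (natural_filtration M B) X (\<lambda>t \<omega>. B t \<omega> $ j) T I"
    and I': "is_ito_integral M (natural_filtration M B) X (\<lambda>t \<omega>. B t \<omega> $ j) T I'"
  shows "AE \<omega> in M. I \<omega> = I' \<omega>"
proof -
  interpret prob_space M by (rule brownian_motionD(1)[OF bm])
  define W where "W = (\<lambda>t \<omega>. B t \<omega> $ j)"
  define dist2 where "dist2 n \<tau> H = (\<integral>\<^sup>+\<omega>. (\<integral>\<^sup>+s\<in>{0..T}.
      ennreal ((elementary_process n \<tau> H s \<omega> - X s \<omega>)\<^sup>2) \<partial>lborel) \<partial>M)" for n \<tau> H
  define err where "err n \<tau> H I = (\<integral>\<^sup>+\<omega>. ennreal ((elementary_integral n \<tau> H W \<omega> - I \<omega>)\<^sup>2) \<partial>M)" for n \<tau> H I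
  from I obtain n \<tau> H where [measurable]: "I \<in> borel_measurable M"
    and el: "\<And>m. elementary_integrand M (natural_filtration M B) T (n m) (\<tau> m) (H m)"
    and lim: "(\<lambda>m. dist2 (n m) (\<tau> m) (H m)) \<longlonglongrightarrow> 0" "(\<lambda>m. err (n m) (\<tau> m) (H m) I) \<longlonglongrightarrow> 0"
    unfolding is_ito_integral_def dist2_def err_def W_def by blast
  from I' obtain n' \<tau>' H' where [measurable]: "I' \<in> borel_measurable M"
    and el': "\<And>m. elementary_integrand M (natural_filtration M B) T (n' m) (\<tau>' m) (H' m)"
    and lim': "(\<lambda>m. dist2 (n' m) (\<tau>' m) (H' m)) \<longlonglongrightarrow> 0" "(\<lambda>m. err (n' m) (\<tau>' m) (H' m) I') \<longlonglongrightarrow> 0"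
    unfolding is_ito_integral_def dist2_def err_def W_def by blast
  have HM: "h k \<in> borel_measurable M"
    if "elementary_integrand M (natural_filtration M B) T q t h" "k < q" for q t h k
    using elementary_integrandD(4)[OF that]
    by (intro measurable_from_natural_filtration[OF brownian_motionD(2)[OF bm], where t="t k"])
  have dist2_Y: "dist2 q t h = (\<integral>\<^sup>+\<omega>. (\<integral>\<^sup>+s\<in>{0..T}.
      ennreal ((elementary_process q t h s \<omega> - Y s \<omega>)\<^sup>2) \<partial>lborel) \<partial>M)" for q t h
    unfolding dist2_def
  proof (rule nn_integral_cong_AE, use XY in eventually_elim)
    case (elim \<omega>)
    then show ?case by (intro nn_integral_cong) (auto simp: indicator_def)
  qed
  have meas: "(\<lambda>x. elementary_process q t h (snd x) (fst x)) \<in> borel_measurable (M \<Otimes>\<^sub>M lborel)"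
    if elq: "elementary_integrand M (natural_filtration M B) T q t h" for q t h
  proof -
    have [measurable]: "(\<lambda>x. h k (fst x)) \<in> borel_measurable (M \<Otimes>\<^sub>M lborel)" if "k < q" for k
      using HM[OF elq that] by (rule measurable_compose[OF measurable_fst])
    show ?thesis unfolding elementary_process_def by (intro borel_measurable_sum) auto
  qed
  have Y': "(\<lambda>x. Y (snd x) (fst x)) \<in> borel_measurable (M \<Otimes>\<^sub>M lborel)"
    using Y by (simp add: split_beta')
  have step: "(\<integral>\<^sup>+\<omega>. ennreal ((elementary_integral (n m) (\<tau> m) (H m) W \<omega> - elementary_integral (n' m) (\<tau>' m) (H' m) W \<omega>)\<^sup>2) \<partial>M)
    \<le> ennreal (\<Sigma> $ j $ j) * (2 * dist2 (n m) (\<tau> m) (H m) + 2 * dist2 (n' m) (\<tau>' m) (H' m))" for m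
  proof -
    \<comment> \<open>The difference of the two elementary integrals is a sum over the disjoint union of both partitions.\<close>
    define K where "K = {..<n m} <+> {..<n' m}"
    define a where "a = case_sum (\<tau> m) (\<tau>' m)"
    define b where "b = case_sum (\<lambda>k. \<tau> m (Suc k)) (\<lambda>k. \<tau>' m (Suc k))"
    define h where "h = case_sum (H m) (\<lambda>k \<omega>. - H' m k \<omega>)"
    define e where "e = (\<lambda>x. elementary_process (n m) (\<tau> m) (H m) (snd x) (fst x))"
    define e' where "e' = (\<lambda>x. elementary_process (n' m) (\<tau>' m) (H' m) (snd x) (fst x))"
    note [measurable] = meas[OF el, of m, folded e_def] meas[OF el', of m, folded e'_def] Y'
    have sumK: "(\<Sum>k\<in>K. f k) = (\<Sum>k<n m. f (Inl k)) + (\<Sum>k<n' m. f (Inr k))" for f :: "_ \<Rightarrow> real"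
      unfolding K_def by (subst sum.Plus) auto
    have "(\<integral>\<^sup>+\<omega>. ennreal ((\<Sum>k\<in>K. h k \<omega> * (B (b k) \<omega> $ j - B (a k) \<omega> $ j))\<^sup>2) \<partial>M)
      = ennreal (\<Sigma> $ j $ j) *
        (\<integral>\<^sup>+\<omega>. (\<integral>\<^sup>+s. ennreal ((\<Sum>k\<in>K. h k \<omega> * indicator {a k<..b k} s)\<^sup>2) \<partial>lborel) \<partial>M)"
    proof (rule ito_isometry[OF bm])
      fix k assume "k \<in> K"
      then show "0 \<le> a k \<and> a k \<le> b k"
        using elementary_integrandD[OF el, of _ m] elementary_integrandD[OF el', of _ m]
        by (auto simp: K_def a_def b_def)
      show "h k \<in> borel_measurable (natural_filtration M B (a k)) \<and> bounded (h k ` space M)"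
        using \<open>k \<in> K\<close> elementary_integrandD[OF el, of _ m] elementary_integrandD[OF el', of _ m]
        by (auto simp: K_def a_def h_def bounded_iff intro!: borel_measurable_uminus)
    qed (simp add: K_def)
    also have "(\<lambda>\<omega>. \<Sum>k\<in>K. h k \<omega> * (B (b k) \<omega> $ j - B (a k) \<omega> $ j))
      = (\<lambda>\<omega>. elementary_integral (n m) (\<tau> m) (H m) W \<omega> - elementary_integral (n' m) (\<tau>' m) (H' m) W \<omega>)"
      unfolding sumK by (simp add: a_def b_def h_def elementary_integral_def W_def sum_negf)
    also have "(\<lambda>\<omega> s. \<Sum>k\<in>K. h k \<omega> * indicator {a k<..b k} s) = (\<lambda>\<omega> s. e (\<omega>, s) - e' (\<omega>, s))"
      unfolding sumK by (simp add: a_def b_def h_def elementary_process_def sum_negf e_def e'_def)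
    also have "(\<integral>\<^sup>+\<omega>. (\<integral>\<^sup>+s. ennreal ((e (\<omega>, s) - e' (\<omega>, s))\<^sup>2) \<partial>lborel) \<partial>M)
      \<le> (\<integral>\<^sup>+\<omega>. (\<integral>\<^sup>+s. 2 * (ennreal ((e (\<omega>, s) - Y s \<omega>)\<^sup>2) * indicator {0..T} s)
          + 2 * (ennreal ((e' (\<omega>, s) - Y s \<omega>)\<^sup>2) * indicator {0..T} s) \<partial>lborel) \<partial>M)"
    proof (intro nn_integral_mono)
      fix \<omega> s
      show "ennreal ((e (\<omega>, s) - e' (\<omega>, s))\<^sup>2) \<le> 2 * (ennreal ((e (\<omega>, s) - Y s \<omega>)\<^sup>2) * indicator {0..T} s)
          + 2 * (ennreal ((e' (\<omega>, s) - Y s \<omega>)\<^sup>2) * indicator {0..T} s)"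
      proof (cases "s \<in> {0..T}")
        case True
        have "(x - y)\<^sup>2 \<le> 2 * (x - z)\<^sup>2 + 2 * (y - z)\<^sup>2" for x y z :: real
          using zero_le_power2[of "(x - z) + (y - z)"] by (simp add: power2_eq_square algebra_simps)
        from ennreal_leI[OF this] True show ?thesis
          by (simp add: ennreal_plus ennreal_mult)
      next
        case False
        have "indicator {\<tau> m k<..\<tau> m (Suc k)} s = (0 :: real)" if "k < n m" for k
          using False elementary_integrandD[OF el that] by (auto simp: indicator_def)
        moreover have "indicator {\<tau>' m k<..\<tau>' m (Suc k)} s = (0 :: real)" if "k < n' m" for k
          using False elementary_integrandD[OF el' that] by (auto simp: indicator_def)
        ultimately have "e (\<omega>, s) = 0" "e' (\<omega>, s) = 0"
          unfolding e_def e'_def elementary_process_def fst_conv snd_conv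
          by (intro sum.neutral ballI; simp only: lessThan_iff mult_zero_right)+
        then show ?thesis by simp
      qed
    qed
    also have "\<dots> = (\<integral>\<^sup>+x. 2 * (ennreal ((e x - Y (snd x) (fst x))\<^sup>2) * indicator {0..T} (snd x))
          + 2 * (ennreal ((e' x - Y (snd x) (fst x))\<^sup>2) * indicator {0..T} (snd x)) \<partial>(M \<Otimes>\<^sub>M lborel))"
      by (subst lborel.nn_integral_fst[symmetric]) auto
    also have "\<dots> = 2 * (\<integral>\<^sup>+x. ennreal ((e x - Y (snd x) (fst x))\<^sup>2) * indicator {0..T} (snd x) \<partial>(M \<Otimes>\<^sub>M lborel))
          + 2 * (\<integral>\<^sup>+x. ennreal ((e' x - Y (snd x) (fst x))\<^sup>2) * indicator {0..T} (snd x) \<partial>(M \<Otimes>\<^sub>M lborel))"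
      by (simp add: nn_integral_add nn_integral_cmult)
    also have "(\<integral>\<^sup>+x. ennreal ((e x - Y (snd x) (fst x))\<^sup>2) * indicator {0..T} (snd x) \<partial>(M \<Otimes>\<^sub>M lborel))
      = dist2 (n m) (\<tau> m) (H m)"
    proof -
      have "dist2 (n m) (\<tau> m) (H m)
        = (\<integral>\<^sup>+\<omega>. (\<integral>\<^sup>+s. ennreal ((e (\<omega>, s) - Y s \<omega>)\<^sup>2) * indicator {0..T} s \<partial>lborel) \<partial>M)"
        unfolding dist2_Y e_def by simp
      then show ?thesis by (subst lborel.nn_integral_fst[symmetric]) auto
    qed
    also have "(\<integral>\<^sup>+x. ennreal ((e' x - Y (snd x) (fst x))\<^sup>2) * indicator {0..T} (snd x) \<partial>(M \<Otimes>\<^sub>M lborel))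
      = dist2 (n' m) (\<tau>' m) (H' m)"
    proof -
      have "dist2 (n' m) (\<tau>' m) (H' m)
        = (\<integral>\<^sup>+\<omega>. (\<integral>\<^sup>+s. ennreal ((e' (\<omega>, s) - Y s \<omega>)\<^sup>2) * indicator {0..T} s \<partial>lborel) \<partial>M)"
        unfolding dist2_Y e'_def by simp
      then show ?thesis by (subst lborel.nn_integral_fst[symmetric]) auto
    qed
    finally show ?thesis by (simp add: mult_left_mono)
  qed
  have bound: "(\<integral>\<^sup>+\<omega>. ennreal ((I \<omega> - I' \<omega>)\<^sup>2) \<partial>M) \<le> 3 * err (n m) (\<tau> m) (H m) I
      + 3 * (ennreal (\<Sigma> $ j $ j) * (2 * dist2 (n m) (\<tau> m) (H m) + 2 * dist2 (n' m) (\<tau>' m) (H' m)))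
      + 3 * err (n' m) (\<tau>' m) (H' m) I'" for m
  proof -
    define E where "E = elementary_integral (n m) (\<tau> m) (H m) W"
    define E' where "E' = elementary_integral (n' m) (\<tau>' m) (H' m) W"
    have [measurable]: "E \<in> borel_measurable M" "E' \<in> borel_measurable M"
      using elementary_integral_brownian(1)[OF bm el] elementary_integral_brownian(1)[OF bm el']
      by (auto simp: E_def E'_def W_def)
    have "(\<integral>\<^sup>+\<omega>. ennreal ((I \<omega> - I' \<omega>)\<^sup>2) \<partial>M)
      \<le> (\<integral>\<^sup>+\<omega>. 3 * ennreal ((E \<omega> - I \<omega>)\<^sup>2) + 3 * ennreal ((E \<omega> - E' \<omega>)\<^sup>2) + 3 * ennreal ((E' \<omega> - I' \<omega>)\<^sup>2) \<partial>M)"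
    proof (rule nn_integral_mono)
      fix \<omega>
      have "(u + v + w)\<^sup>2 \<le> 3 * u\<^sup>2 + 3 * v\<^sup>2 + 3 * w\<^sup>2" for u v w :: real
        using zero_le_power2[of "u - v"] zero_le_power2[of "v - w"] zero_le_power2[of "u - w"]
        by (simp add: power2_eq_square algebra_simps)
      from this[of "I \<omega> - E \<omega>" "E \<omega> - E' \<omega>" "E' \<omega> - I' \<omega>"]
      have "(I \<omega> - I' \<omega>)\<^sup>2 \<le> 3 * (E \<omega> - I \<omega>)\<^sup>2 + 3 * (E \<omega> - E' \<omega>)\<^sup>2 + 3 * (E' \<omega> - I' \<omega>)\<^sup>2"
        by (simp add: power2_commute[of "I \<omega>" "E \<omega>"])
      from ennreal_leI[OF this]
      show "ennreal ((I \<omega> - I' \<omega>)\<^sup>2)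
        \<le> 3 * ennreal ((E \<omega> - I \<omega>)\<^sup>2) + 3 * ennreal ((E \<omega> - E' \<omega>)\<^sup>2) + 3 * ennreal ((E' \<omega> - I' \<omega>)\<^sup>2)"
        by (simp add: ennreal_plus ennreal_mult)
    qed
    also have "\<dots> = 3 * (\<integral>\<^sup>+\<omega>. ennreal ((E \<omega> - I \<omega>)\<^sup>2) \<partial>M) + 3 * (\<integral>\<^sup>+\<omega>. ennreal ((E \<omega> - E' \<omega>)\<^sup>2) \<partial>M)
        + 3 * (\<integral>\<^sup>+\<omega>. ennreal ((E' \<omega> - I' \<omega>)\<^sup>2) \<partial>M)"
      by (simp add: nn_integral_add nn_integral_cmult)
    also have "\<dots> \<le> 3 * err (n m) (\<tau> m) (H m) I
      + 3 * (ennreal (\<Sigma> $ j $ j) * (2 * dist2 (n m) (\<tau> m) (H m) + 2 * dist2 (n' m) (\<tau>' m) (H' m)))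
      + 3 * err (n' m) (\<tau>' m) (H' m) I'"
      unfolding err_def E_def[symmetric] E'_def[symmetric]
      using step[of m, folded E_def E'_def] by (intro add_mono mult_left_mono order_refl) auto
    finally show ?thesis .
  qed
  have "(\<lambda>m. 3 * err (n m) (\<tau> m) (H m) I
      + 3 * (ennreal (\<Sigma> $ j $ j) * (2 * dist2 (n m) (\<tau> m) (H m) + 2 * dist2 (n' m) (\<tau>' m) (H' m)))
      + 3 * err (n' m) (\<tau>' m) (H' m) I')
    \<longlonglongrightarrow> 3 * 0 + 3 * (ennreal (\<Sigma> $ j $ j) * (2 * 0 + 2 * 0)) + 3 * 0"
    by (intro tendsto_add ennreal_tendsto_cmult lim lim') auto
  then have "(\<integral>\<^sup>+\<omega>. ennreal ((I \<omega> - I' \<omega>)\<^sup>2) \<partial>M) \<le> 3 * 0 + 3 * (ennreal (\<Sigma> $ j $ j) * (2 * 0 + 2 * 0)) + 3 * 0"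
    using bound by (intro LIMSEQ_le_const) auto
  then have "(\<integral>\<^sup>+\<omega>. ennreal ((I \<omega> - I' \<omega>)\<^sup>2) \<partial>M) = 0" by simp
  then have "AE \<omega> in M. ennreal ((I \<omega> - I' \<omega>)\<^sup>2) = 0"
    by (subst (asm) nn_integral_0_iff_AE) auto
  then show ?thesis by eventually_elim (simp add: ennreal_eq_0_iff)
qed

lemma brownian_ito_integral_unique:
  fixes B :: "real \<Rightarrow> 'w \<Rightarrow> real ^ 'd"
  assumes bm: "brownian_motion M B \<Sigma>"
    and "is_ito_integral M (natural_filtration M B) (\<lambda>t \<omega>. B t \<omega> $ i) (\<lambda>t \<omega>. B t \<omega> $ j) T I"
    and "is_ito_integral M (natural_filtration M B) (\<lambda>t \<omega>. B t \<omega> $ i) (\<lambda>t \<omega>. B t \<omega> $ j) T I'"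
  shows "AE \<omega> in M. I \<omega> = I' \<omega>"
proof -
  obtain Y where "(\<lambda>(\<omega>, s). Y s \<omega>) \<in> borel_measurable (M \<Otimes>\<^sub>M lborel)"
    and "AE \<omega> in M. \<forall>s\<ge>0. Y s \<omega> = B s \<omega> $ i"
    by (rule brownian_motion_jointly_measurable_version[OF bm])
  from ito_integral_unique_of_measurable_version[OF bm this assms(2,3)]
  show ?thesis .
qed

section \<open>Iterated integrals of a stationary process\<close>

lemma bounded_linear_entry: "bounded_linear (\<lambda>A :: real ^ 'n ^ 'm. A $ i $ j)"
  by (rule bounded_linear_compose[OF bounded_linear_vec_nth bounded_linear_vec_nth])

text \<open>
  The pathwise and second-moment facts about \<open>\<Xi>\<close> that do not involve the limit are collected in a
  locale. Taking \<open>s = 0\<close> in the last assumption, \<open>\<Xi> 0\<close> is square integrable.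
\<close>

locale stationary_L2_process = prob_space M for M :: "'v measure" +
  fixes \<Xi> :: "real \<Rightarrow> 'v \<Rightarrow> real ^ 'd"
  assumes jointly_measurable: "measurable_process M \<Xi>"
    and stationary: "stationary_process M \<Xi>"
    and integrable_tensor: "0 \<le> s \<Longrightarrow> integrable M (\<lambda>\<omega>. \<Xi> 0 \<omega> \<otimes>\<^sub>t \<Xi> s \<omega>)"
begin

text \<open>
  Time is clipped at \<open>0\<close>, so that the coordinates are jointly measurable on the whole real line and the
  Fubini's theorem applies with Lebesgue measure in the time variable.
\<close>

definition coord :: "'d \<Rightarrow> real \<Rightarrow> 'v \<Rightarrow> real" where
  "coord i t \<omega> = \<Xi> (max 0 t) \<omega> $ i"

text \<open>
  For \<open>s \<ge> 0\<close> an entry of \<open>autocorrelation\<close>; clipping makes it measurable on the whole line.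
\<close>

definition corr :: "'d \<Rightarrow> 'd \<Rightarrow> real \<Rightarrow> real" where
  "corr i j s = (\<integral>\<omega>. coord i 0 \<omega> * coord j s \<omega> \<partial>M)"

lemma measurable_coord_pair: "(\<lambda>(t, \<omega>). coord i t \<omega>) \<in> borel_measurable (borel \<Otimes>\<^sub>M M)"
proof -
  have "(\<lambda>(t, \<omega>). (max 0 t, \<omega>)) \<in> borel \<Otimes>\<^sub>M M \<rightarrow>\<^sub>M restrict_space borel {0 :: real..} \<Otimes>\<^sub>M M"
    unfolding split_beta'
    by (intro measurable_Pair measurable_restrict_space2 measurable_snd) auto
  from measurable_compose[OF this jointly_measurable[unfolded measurable_process_def]]
  have "(\<lambda>p. \<Xi> (max 0 (fst p)) (snd p)) \<in> borel_measurable (borel \<Otimes>\<^sub>M M)"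
    by (simp add: split_beta')
  from measurable_compose[OF this borel_measurable_nth] show ?thesis
    by (simp add: coord_def split_beta')
qed

lemma measurable_coord [measurable (raw)]:
  assumes "f \<in> borel_measurable N" "g \<in> N \<rightarrow>\<^sub>M M"
  shows "(\<lambda>x. coord i (f x) (g x)) \<in> borel_measurable N"
  using measurable_compose[OF measurable_Pair[OF assms] measurable_coord_pair, of i] by simp

lemma measurable_value: "0 \<le> t \<Longrightarrow> \<Xi> t \<in> borel_measurable M"
  using measurable_compose[OF measurable_Pair1'[of t "restrict_space borel {0..}" M]
      jointly_measurable[unfolded measurable_process_def]]
  by (simp add: space_restrict_space)

lemma stationary_pair:
  assumes "0 \<le> r" "r \<le> u"
  shows "integrable M (\<lambda>\<omega>. coord i r \<omega> * coord j u \<omega>)"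
    and "(\<integral>\<omega>. coord i r \<omega> * coord j u \<omega> \<partial>M) = corr i j (u - r)"
proof -
  define J where "J = {0, u - r}"
  have J: "finite J" "J \<subseteq> {0..}" "0 \<in> J" "u - r \<in> J" using assms by (auto simp: J_def)
  define P where "P = PiM J (\<lambda>_. borel :: (real ^ 'd) measure)"
  define g where "g y = y 0 $ i * y (u - r) $ j" for y :: "real \<Rightarrow> real ^ 'd"
  have g: "g \<in> borel_measurable P"
    unfolding g_def[abs_def] P_def
    by (intro borel_measurable_times measurable_compose[OF _ borel_measurable_nth]
        measurable_component_singleton J)
  have meas: "(\<lambda>\<omega>. \<lambda>s\<in>J. \<Xi> (s + h) \<omega>) \<in> M \<rightarrow>\<^sub>M P" if "0 \<le> h" for h
    unfolding P_def using J(2) that by (intro measurable_restrict measurable_value) auto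
  have eq: "distr M P (\<lambda>\<omega>. \<lambda>s\<in>J. \<Xi> (s + r) \<omega>) = distr M P (\<lambda>\<omega>. \<lambda>s\<in>J. \<Xi> (s + 0) \<omega>)"
    using stationary J(1,2) assms(1) unfolding stationary_process_def P_def by simp
  have g_val: "g (\<lambda>s\<in>J. \<Xi> (s + r) \<omega>) = coord i r \<omega> * coord j u \<omega>"
    "g (\<lambda>s\<in>J. \<Xi> (s + 0) \<omega>) = coord i 0 \<omega> * coord j (u - r) \<omega>" for \<omega>
    using J assms by (simp_all add: g_def coord_def)
  have "integrable M (\<lambda>\<omega>. coord i 0 \<omega> * coord j (u - r) \<omega>)"
    using integrable_bounded_linear[OF bounded_linear_entry integrable_tensor[of "u - r"], of i j] assms
    by (simp add: tensor_def coord_def)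
  then show "integrable M (\<lambda>\<omega>. coord i r \<omega> * coord j u \<omega>)"
    using integrable_distr_eq[OF meas g, of r] integrable_distr_eq[OF meas g, of 0] eq assms
    unfolding g_val by simp
  show "(\<integral>\<omega>. coord i r \<omega> * coord j u \<omega> \<partial>M) = corr i j (u - r)"
    using integral_distr[OF meas g, of r] integral_distr[OF meas g, of 0] eq assms
    unfolding g_val corr_def by simp
qed

lemma coord_square:
  assumes "0 \<le> t"
  shows "integrable M (\<lambda>\<omega>. (coord i t \<omega>)\<^sup>2)" "(\<integral>\<omega>. (coord i t \<omega>)\<^sup>2 \<partial>M) = corr i i 0"
  using stationary_pair[OF assms order_refl, of i i] by (simp_all add: power2_eq_square)

lemma autocorrelation_component:
  assumes "0 \<le> s"
  shows "autocorrelation M \<Xi> s $ i $ j = corr i j s"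
  using integral_bounded_linear[OF bounded_linear_entry integrable_tensor[OF assms], of i j] assms
  by (simp add: autocorrelation_def corr_def coord_def tensor_def)

lemma nn_integral_coord_product:
  assumes "0 \<le> r" "0 \<le> u"
  shows "(\<integral>\<^sup>+\<omega>. ennreal \<bar>coord i r \<omega> * coord j u \<omega>\<bar> \<partial>M) \<le> ennreal (corr i i 0 + corr j j 0)"
proof -
  have "(\<integral>\<^sup>+\<omega>. ennreal \<bar>coord i r \<omega> * coord j u \<omega>\<bar> \<partial>M)
    \<le> (\<integral>\<^sup>+\<omega>. ennreal ((coord i r \<omega>)\<^sup>2 + (coord j u \<omega>)\<^sup>2) \<partial>M)"
  proof (intro nn_integral_mono ennreal_leI)
    fix \<omega>
    show "\<bar>coord i r \<omega> * coord j u \<omega>\<bar> \<le> (coord i r \<omega>)\<^sup>2 + (coord j u \<omega>)\<^sup>2"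
      using sum_squares_bound[of "\<bar>coord i r \<omega>\<bar>" "\<bar>coord j u \<omega>\<bar>"]
        mult_nonneg_nonneg[OF abs_ge_zero abs_ge_zero, of "coord i r \<omega>" "coord j u \<omega>"]
      unfolding abs_mult power2_abs by linarith
  qed
  also have "\<dots> = ennreal (corr i i 0 + corr j j 0)"
    using coord_square[OF assms(1), of i] coord_square[OF assms(2), of j]
    by (subst nn_integral_eq_integral) auto
  finally show ?thesis .
qed

text \<open>
  Integer horizons suffice, so the exceptional null set can be chosen independently of \<open>v\<close>.
\<close>

lemma AE_path_integrable:
  "AE \<omega> in M. \<forall>i v. set_integrable lborel {0..v} (\<lambda>s. coord i s \<omega>)"
proof -
  interpret P: pair_sigma_finite lborel M by standard
  have "AE \<omega> in M. set_integrable lborel {0..real n} (\<lambda>s. coord i s \<omega>)" for i and n :: nat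
  proof -
    have "integrable (lborel \<Otimes>\<^sub>M M) (\<lambda>(s, \<omega>). indicator {0..real n} s * coord i s \<omega>)"
    proof (rule integrableI_bounded)
      have "(\<integral>\<^sup>+p. ennreal (norm (case p of (s, \<omega>) \<Rightarrow> indicator {0..real n} s * coord i s \<omega>)) \<partial>(lborel \<Otimes>\<^sub>M M))
        = (\<integral>\<^sup>+s. (\<integral>\<^sup>+\<omega>. ennreal \<bar>indicator {0..real n} s * coord i s \<omega>\<bar> \<partial>M) \<partial>lborel)"
        by (subst nn_integral_fst[symmetric]) auto
      also have "\<dots> \<le> (\<integral>\<^sup>+s. ennreal (corr i i 0 + 1) * indicator {0..real n} s \<partial>lborel)"
      proof (rule nn_integral_mono)
        fix s :: real
        show "(\<integral>\<^sup>+\<omega>. ennreal \<bar>indicator {0..real n} s * coord i s \<omega>\<bar> \<partial>M)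
          \<le> ennreal (corr i i 0 + 1) * indicator {0..real n} s"
        proof (cases "s \<in> {0..real n}")
          case True
          have "(\<integral>\<^sup>+\<omega>. ennreal \<bar>coord i s \<omega>\<bar> \<partial>M) \<le> (\<integral>\<^sup>+\<omega>. ennreal ((coord i s \<omega>)\<^sup>2 + 1) \<partial>M)"
          proof (intro nn_integral_mono ennreal_leI)
            fix \<omega>
            show "\<bar>coord i s \<omega>\<bar> \<le> (coord i s \<omega>)\<^sup>2 + 1"
              using sum_squares_bound[of "\<bar>coord i s \<omega>\<bar>" 1] by simp
          qed
          also have "\<dots> = ennreal (corr i i 0 + 1)"
            using coord_square[of s i] True by (subst nn_integral_eq_integral) (auto simp: prob_space)
          finally show ?thesis using True by simp
        qed simp
      qed
      also have "\<dots> < \<infinity>" by (simp add: nn_integral_cmult ennreal_mult_less_top)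
      finally show "(\<integral>\<^sup>+p. ennreal (norm (case p of (s, \<omega>) \<Rightarrow> indicator {0..real n} s * coord i s \<omega>)) \<partial>(lborel \<Otimes>\<^sub>M M)) < \<infinity>" .
    qed measurable
    from P.AE_integrable_snd[OF this] show ?thesis
      by (simp add: set_integrable_def)
  qed
  then have "AE \<omega> in M. \<forall>i. \<forall>n :: nat. set_integrable lborel {0..real n} (\<lambda>s. coord i s \<omega>)"
    by (simp add: AE_all_countable AE_finite_all)
  then show ?thesis
  proof eventually_elim
    case (elim \<omega>)
    show ?case
    proof (intro allI)
      fix i v
      obtain n :: nat where "v \<le> real n" using real_arch_simple by blast
      then show "set_integrable lborel {0..v} (\<lambda>s. coord i s \<omega>)"
        using elim by (auto intro: set_integrable_subset[of lborel "{0..real n}"])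
    qed
  qed
qed

text \<open>
  The iterated integral of \<open>\<Xi>\<close> over \<open>[0, L]\<close> without rescaling, as a Lebesgue integral.
\<close>

definition path_iterated_integral :: "'d \<Rightarrow> 'd \<Rightarrow> real \<Rightarrow> 'v \<Rightarrow> real" where
  "path_iterated_integral i j L \<omega> =
    (LINT u:{0..L}|lborel. (LINT r:{0..u}|lborel. coord i r \<omega>) * coord j u \<omega>)"

lemma measurable_path_iterated_integral [measurable]:
  "path_iterated_integral i j L \<in> borel_measurable M"
  unfolding path_iterated_integral_def[abs_def] set_lebesgue_integral_def indicator_def atLeastAtMost_iff
  by measurable

lemma corr_bounded: "0 \<le> s \<Longrightarrow> \<bar>corr i j s\<bar> \<le> corr i i 0 + corr j j 0"
proof -
  assume "0 \<le> s"
  have nonneg: "0 \<le> corr i i 0 + corr j j 0"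
    by (auto simp: corr_def intro!: add_nonneg_nonneg Bochner_Integration.integral_nonneg)
  have "\<bar>corr i j s\<bar> \<le> (\<integral>\<omega>. \<bar>coord i 0 \<omega> * coord j s \<omega>\<bar> \<partial>M)"
    unfolding corr_def by (rule integral_abs_bound)
  then have "ennreal \<bar>corr i j s\<bar> \<le> ennreal (\<integral>\<omega>. \<bar>coord i 0 \<omega> * coord j s \<omega>\<bar> \<partial>M)"
    by (rule ennreal_leI)
  also have "\<dots> = (\<integral>\<^sup>+\<omega>. ennreal \<bar>coord i 0 \<omega> * coord j s \<omega>\<bar> \<partial>M)"
    using stationary_pair(1)[OF order_refl \<open>0 \<le> s\<close>, of i j]
    by (subst nn_integral_eq_integral) auto
  also have "\<dots> \<le> ennreal (corr i i 0 + corr j j 0)"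
    by (rule nn_integral_coord_product[OF order_refl \<open>0 \<le> s\<close>])
  finally show ?thesis by (simp only: ennreal_le_iff[OF nonneg])
qed

lemma measurable_corr [measurable]: "corr i j \<in> borel_measurable borel"
  unfolding corr_def[abs_def] by measurable

lemma set_integrable_corr: "set_integrable lborel {0..u} (corr i j)"
  unfolding set_integrable_def
proof (rule Bochner_Integration.integrable_bound)
  show "integrable lborel (\<lambda>s. (corr i i 0 + corr j j 0) * indicator {0..u} s :: real)"
    by (intro integrable_mult_right integrable_real_indicator) (auto simp: emeasure_lborel_Icc_eq)
  show "AE s in lborel. norm (indicator {0..u} s *\<^sub>R corr i j s) \<le> norm ((corr i i 0 + corr j j 0) * indicator {0..u} s)"
    using corr_bounded[of _ i j] by (intro AE_I2) (force simp: indicator_def)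
qed measurable

text \<open>
  Fubini on the triangle \<open>0 \<le> r \<le> u \<le> L\<close>, where the expectation of the integrand is
  \<open>corr i j (u - r)\<close>; the reflection \<open>r \<mapsto> u - r\<close> gives the inner integral.
\<close>

lemma expectation_path_iterated_integral:
  "(\<integral>\<omega>. path_iterated_integral i j L \<omega> \<partial>M) = integral {0..L} (\<lambda>u. integral {0..u} (corr i j))"
proof -
  interpret P: pair_sigma_finite "lborel :: (real \<times> real) measure" M by standard
  define T where "T = {(u, r). 0 \<le> r \<and> r \<le> u \<and> u \<le> L}"
  define f where "f = (\<lambda>((u, r), \<omega>). indicator T (u, r) * (coord i r \<omega> * coord j u \<omega>))"
  have T[measurable]: "T \<in> sets (borel :: (real \<times> real) measure)"
  proof (rule borel_closed)
    have "T = {p. 0 \<le> snd p} \<inter> {p. snd p \<le> fst p} \<inter> {p. fst p \<le> L}" by (auto simp: T_def)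
    also have "closed \<dots>" by (intro closed_Int closed_Collect_le continuous_intros)
    finally show "closed T" .
  qed
  have f_meas: "f \<in> borel_measurable (lborel \<Otimes>\<^sub>M M)"
  proof -
    have [measurable]: "fst \<in> borel_measurable (lborel :: (real \<times> real) measure)"
      "snd \<in> borel_measurable (lborel :: (real \<times> real) measure)"
      by (auto intro!: borel_measurable_continuous_onI continuous_intros)
    show ?thesis unfolding f_def split_beta' prod.collapse by measurable
  qed
  have "T \<subseteq> {0..L} \<times> {0..L}" by (auto simp: T_def)
  then have finT: "emeasure lborel T < \<infinity>"
  proof -
    have "bounded T" using \<open>T \<subseteq> {0..L} \<times> {0..L}\<close> by (rule bounded_subset[rotated]) (auto intro!: bounded_Times)
    then show ?thesis by (rule emeasure_bounded_finite)
  qed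
  have f: "integrable (lborel \<Otimes>\<^sub>M M) f"
  proof (rule integrableI_bounded[OF f_meas])
    have "(\<integral>\<^sup>+p. ennreal (norm (f p)) \<partial>(lborel \<Otimes>\<^sub>M M)) = (\<integral>\<^sup>+q. (\<integral>\<^sup>+\<omega>. ennreal (norm (f (q, \<omega>))) \<partial>M) \<partial>lborel)"
      using f_meas by (subst nn_integral_fst[symmetric]) auto
    also have "\<dots> \<le> (\<integral>\<^sup>+q. ennreal (corr i i 0 + corr j j 0) * indicator T q \<partial>lborel)"
    proof (rule nn_integral_mono)
      fix q :: "real \<times> real"
      show "(\<integral>\<^sup>+\<omega>. ennreal (norm (f (q, \<omega>))) \<partial>M) \<le> ennreal (corr i i 0 + corr j j 0) * indicator T q"
      proof (cases "q \<in> T")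
        case True
        then show ?thesis using nn_integral_coord_product[of "snd q" "fst q" i j]
          by (cases q) (auto simp: f_def T_def)
      next
        case False
        then show ?thesis by (cases q) (simp add: f_def)
      qed
    qed
    also have "\<dots> < \<infinity>" using finT by (simp add: nn_integral_cmult ennreal_mult_less_top)
    finally show "(\<integral>\<^sup>+p. ennreal (norm (f p)) \<partial>(lborel \<Otimes>\<^sub>M M)) < \<infinity>" .
  qed
  have T_ind: "indicator T (u, r) = (indicator {0..L} u * indicator {0..u} r :: real)" for u r
    by (auto simp: T_def indicator_def)
  have iter: "(\<integral>q. g q \<partial>lborel) = (\<integral>u. (\<integral>r. g (u, r) \<partial>lborel) \<partial>lborel)"
    if "integrable lborel g" for g :: "real \<times> real \<Rightarrow> real"
    using lborel_pair.integral_fst'[of g] that by (simp add: lborel_prod)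
  have "(\<integral>\<omega>. path_iterated_integral i j L \<omega> \<partial>M) = (\<integral>\<omega>. (\<integral>q. f (q, \<omega>) \<partial>lborel) \<partial>M)"
  proof (rule integral_cong_AE)
    show "AE \<omega> in M. path_iterated_integral i j L \<omega> = (\<integral>q. f (q, \<omega>) \<partial>lborel)"
    proof -
      have "AE \<omega> in M. integrable lborel (\<lambda>q. f (q, \<omega>))"
        using P.AE_integrable_snd[of "\<lambda>q \<omega>. f (q, \<omega>)"] f by simp
      then show ?thesis
      proof eventually_elim
        case (elim \<omega>)
        have "(\<integral>r. f ((u, r), \<omega>) \<partial>lborel)
            = indicator {0..L} u * ((LINT r:{0..u}|lborel. coord i r \<omega>) * coord j u \<omega>)" for u
        proof -
          have "f ((u, r), \<omega>) = indicator {0..L} u * coord j u \<omega> * (indicator {0..u} r * coord i r \<omega>)" for r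
            by (simp add: f_def T_ind)
          then show ?thesis by (simp add: set_lebesgue_integral_def)
        qed
        then show ?case
          unfolding iter[OF elim] path_iterated_integral_def set_lebesgue_integral_def by simp
      qed
    qed
    show "(\<lambda>\<omega>. \<integral>q. f (q, \<omega>) \<partial>lborel) \<in> borel_measurable M"
      using P.integrable_snd[of "\<lambda>q \<omega>. f (q, \<omega>)"] f by auto
  qed measurable
  also have "\<dots> = (\<integral>q. (\<integral>\<omega>. f (q, \<omega>) \<partial>M) \<partial>lborel)"
    using P.Fubini_integral[of "\<lambda>q \<omega>. f (q, \<omega>)"] f by simp
  also have "\<dots> = (\<integral>u. (\<integral>r. (\<integral>\<omega>. f ((u, r), \<omega>) \<partial>M) \<partial>lborel) \<partial>lborel)"
    using P.integrable_fst[of "\<lambda>q \<omega>. f (q, \<omega>)"] f by (intro iter) simp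
  also have "\<dots> = (\<integral>u. indicator {0..L} u * integral {0..u} (corr i j) \<partial>lborel)"
  proof (rule Bochner_Integration.integral_cong[OF refl])
    fix u :: real
    have "(\<integral>\<omega>. f ((u, r), \<omega>) \<partial>M) = indicator {0..L} u * (indicator {0..u} r * corr i j (u - r))" for r
    proof -
      have "(\<integral>\<omega>. f ((u, r), \<omega>) \<partial>M)
        = indicator {0..L} u * indicator {0..u} r * (\<integral>\<omega>. coord i r \<omega> * coord j u \<omega> \<partial>M)"
        by (simp add: f_def T_ind)
      then show ?thesis by (cases "r \<in> {0..u}") (auto simp: stationary_pair(2))
    qed
    then have "(\<integral>r. (\<integral>\<omega>. f ((u, r), \<omega>) \<partial>M) \<partial>lborel)
      = (\<integral>r. indicator {0..L} u * (indicator {0..u} r * corr i j (u - r)) \<partial>lborel)"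
      by simp
    also have "\<dots> = indicator {0..L} u * (\<integral>r. indicator {0..u} r * corr i j (u - r) \<partial>lborel)"
      by simp
    also have "(\<integral>r. indicator {0..u} r * corr i j (u - r) \<partial>lborel) = (\<integral>s. indicator {0..u} s * corr i j s \<partial>lborel)"
      by (subst lborel_integral_real_affine[where c="-1" and t=u])
        (auto intro!: Bochner_Integration.integral_cong simp: indicator_def)
    also have "\<dots> = integral {0..u} (corr i j)"
      using set_borel_integral_eq_integral(2)[OF set_integrable_corr[of u i j]]
      by (simp add: set_lebesgue_integral_def)
    finally show "(\<integral>r. (\<integral>\<omega>. f ((u, r), \<omega>) \<partial>M) \<partial>lborel) = indicator {0..L} u * integral {0..u} (corr i j)" .
  qed
  also have "\<dots> = integral {0..L} (\<lambda>u. integral {0..u} (corr i j))"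
  proof -
    have "corr i j integrable_on {0..L}"
      by (rule set_borel_integral_eq_integral(1)[OF set_integrable_corr])
    then have "continuous_on {0..L} (\<lambda>u. integral {0..u} (corr i j))"
      by (rule indefinite_integral_continuous_1)
    then have "set_integrable lborel {0..L} (\<lambda>u. integral {0..u} (corr i j))"
      unfolding set_integrable_def by (rule borel_integrable_compact[OF compact_Icc])
    from set_borel_integral_eq_integral(2)[OF this] show ?thesis
      by (simp add: set_lebesgue_integral_def)
  qed
  finally show ?thesis .
qed

lemma rescaled_integral_component:
  assumes "\<And>i v. set_integrable lborel {0..v} (\<lambda>s. coord i s \<omega>)"
  shows "rescaled_integral \<Xi> N t \<omega> $ i = (1 / sqrt (real N)) * (LINT s:{0..real N * t}|lborel. coord i s \<omega>)"
proof -
  let ?v = "real N * t"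
  have eq: "indicator {0..?v} s *\<^sub>R \<Xi> s \<omega> = (\<Sum>i\<in>UNIV. (indicator {0..?v} s *\<^sub>R coord i s \<omega>) *\<^sub>R axis i 1)" for s
    by (auto simp: vec_eq_iff axis_def coord_def indicator_def if_distrib cong: if_cong)
  have "integrable lborel (\<lambda>s. indicator {0..?v} s *\<^sub>R \<Xi> s \<omega>)"
    unfolding eq using assms unfolding set_integrable_def
    by (intro Bochner_Integration.integrable_sum integrable_scaleR_left) auto
  from integral_bounded_linear[OF bounded_linear_vec_nth this, of i]
  have "(LINT s:{0..?v}|lborel. \<Xi> s \<omega>) $ i = (\<integral>s. (indicator {0..?v} s *\<^sub>R \<Xi> s \<omega>) $ i \<partial>lborel)"
    by (simp add: set_lebesgue_integral_def)
  also have "\<dots> = (LINT s:{0..?v}|lborel. coord i s \<omega>)"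
    unfolding set_lebesgue_integral_def
    by (intro Bochner_Integration.integral_cong) (auto simp: coord_def indicator_def)
  finally show ?thesis by (simp add: rescaled_integral_def)
qed

text \<open>
  The two factors \<open>1 / sqrt N\<close> combine to \<open>1 / N\<close>; the change of time \<open>s \<mapsto> N s\<close> leaves a Riemann-Stieltjes
  integral unchanged.
\<close>

lemma has_rs_integral_rescaled_integral:
  assumes "\<And>i v. set_integrable lborel {0..v} (\<lambda>s. coord i s \<omega>)" "N \<ge> 1"
  shows "has_rs_integral (\<lambda>s. rescaled_integral \<Xi> N s \<omega> $ i) (\<lambda>s. rescaled_integral \<Xi> N s \<omega> $ j) 0 1
    (path_iterated_integral i j (real N) \<omega> / real N)"
proof -
  let ?\<phi> = "\<lambda>i v. LINT s:{0..v}|lborel. coord i s \<omega>"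
  have "continuous_on {0..real N} (?\<phi> i)"
    using indefinite_integral_continuous_1[OF set_borel_integral_eq_integral(1)[OF assms(1)[of "real N" i]]]
    by (simp add: set_borel_integral_eq_integral(2)[OF assms(1)])
  then have "has_rs_integral (?\<phi> i) (?\<phi> j) 0 (real N) (path_iterated_integral i j (real N) \<omega>)"
    unfolding path_iterated_integral_def
    by (intro has_rs_integral_indefinite_integral assms(1))
  from has_rs_integral_rescale[OF this, of "1 / sqrt (real N)"] assms(2)
  show ?thesis
    by (simp add: rescaled_integral_component[OF assms(1)] power_divide)
qed

lemma AE_rescaled_iterated_integral:
  assumes "N \<ge> 1"
  shows "AE \<omega> in M. \<forall>i j. rescaled_iterated_integral \<Xi> N 1 \<omega> $ i $ j = path_iterated_integral i j (real N) \<omega> / real N \<and>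
    rescaled_integral \<Xi> N 1 \<omega> $ i * rescaled_integral \<Xi> N 1 \<omega> $ j
      = rescaled_iterated_integral \<Xi> N 1 \<omega> $ i $ j + rescaled_iterated_integral \<Xi> N 1 \<omega> $ j $ i"
  using AE_path_integrable
proof eventually_elim
  case (elim \<omega>)
  then have ok: "\<And>i v. set_integrable lborel {0..v} (\<lambda>s. coord i s \<omega>)" by blast
  note rs = has_rs_integral_rescaled_integral[OF ok assms]
  have val: "rescaled_iterated_integral \<Xi> N 1 \<omega> $ i $ j = path_iterated_integral i j (real N) \<omega> / real N" for i j
    using rs_integral_eqI[OF rs] by (simp add: rescaled_iterated_integral_def iterated_rs_integral_def)
  have zero: "rescaled_integral \<Xi> N 0 \<omega> $ i = 0" for i
    using set_integral_point[of 0 "\<lambda>s. coord i s \<omega>"] by (simp add: rescaled_integral_component[OF ok])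
  show ?case
    using has_rs_integral_by_parts[OF rs rs] by (auto simp: val zero)
qed

lemma expectation_rescaled_iterated_integral:
  assumes "N \<ge> 1" "integrable M (rescaled_iterated_integral \<Xi> N 1)"
  shows "(\<integral>\<omega>. rescaled_iterated_integral \<Xi> N 1 \<omega> \<partial>M) $ i $ j
    = integral {0..real N} (\<lambda>u. integral {0..u} (corr i j)) / real N"
proof -
  have "(\<integral>\<omega>. rescaled_iterated_integral \<Xi> N 1 \<omega> \<partial>M) $ i $ j
    = (\<integral>\<omega>. rescaled_iterated_integral \<Xi> N 1 \<omega> $ i $ j \<partial>M)"
    using integral_bounded_linear[OF bounded_linear_entry assms(2), of i j] by simp
  also have "\<dots> = (\<integral>\<omega>. path_iterated_integral i j (real N) \<omega> / real N \<partial>M)"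
  proof (rule integral_cong_AE)
    show "AE \<omega> in M. rescaled_iterated_integral \<Xi> N 1 \<omega> $ i $ j = path_iterated_integral i j (real N) \<omega> / real N"
      using AE_rescaled_iterated_integral[OF assms(1)] by eventually_elim blast
    show "(\<lambda>\<omega>. rescaled_iterated_integral \<Xi> N 1 \<omega> $ i $ j) \<in> borel_measurable M"
      using integrable_bounded_linear[OF bounded_linear_entry assms(2), of i j] by auto
  qed measurable
  finally show ?thesis by (simp add: expectation_path_iterated_integral)
qed

end

text \<open>
  The Henstock-Kurzweil integral over an unbounded set is defined by exhausting it with boxes, so this
  covers conditionally convergent integrals, to which dominated convergence does not apply.
\<close>

lemma integral_atLeast_tendsto:
  fixes f :: "real \<Rightarrow> real"
  assumes "f integrable_on {a..}"
  shows "((\<lambda>u. integral {a..u} f) \<longlongrightarrow> integral {a..} f) at_top"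
proof (rule tendstoI)
  fix e :: real assume "e > 0"
  have "(f has_integral integral {a..} f) {a..}" using assms by (rule integrable_integral)
  then obtain K where "K > 0" and K: "\<And>c d. ball 0 K \<subseteq> cbox c d \<Longrightarrow>
      \<exists>z. ((\<lambda>x. if x \<in> {a..} then f x else 0) has_integral z) (cbox c d) \<and> norm (z - integral {a..} f) < e"
    using \<open>e > 0\<close> by (subst (asm) has_integral_alt') (auto simp: has_integral_integrable_integral)
  have "dist (integral {a..u} f) (integral {a..} f) < e" if "u \<ge> K" for u
  proof -
    define c where "c = min a (- K)"
    have "ball 0 K \<subseteq> cbox c u" using that by (auto simp: c_def)
    from K[OF this] obtain z where "((\<lambda>x. if x \<in> {a..} then f x else 0) has_integral z) (cbox c u)"
      and z: "norm (z - integral {a..} f) < e" by blast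
    then have "(f has_integral z) ({a..} \<inter> cbox c u)"
      by (simp only: has_integral_restrict_Int)
    moreover have "{a..} \<inter> cbox c u = {a..u}" by (auto simp: c_def)
    ultimately have "(f has_integral z) {a..u}" by (simp only:)
    then show ?thesis using z by (simp add: integral_unique dist_norm)
  qed
  then show "\<forall>\<^sub>F u in at_top. dist (integral {a..u} f) (integral {a..} f) < e"
    by (auto simp: eventually_at_top_linorder)
qed

text \<open>
  L'Hopital's rule, since the derivative of the numerator is \<open>D\<close>.
\<close>

lemma cesaro_integral_tendsto:
  fixes D :: "real \<Rightarrow> real"
  assumes cont: "continuous_on {0..} D" and lim: "(D \<longlongrightarrow> l) at_top"
  shows "(\<lambda>N. integral {0..real N} D / real N) \<longlonglongrightarrow> l"
proof -
  have "((\<lambda>x. integral {0..x} D / x) \<longlongrightarrow> l) at_top"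
  proof (rule lhospital_at_top_at_top[where f'=D and g'="\<lambda>_. 1"])
    show "\<forall>\<^sub>F x in at_top. ((\<lambda>x. integral {0..x} D) has_real_derivative D x) (at x)"
      using eventually_gt_at_top[of 0]
    proof eventually_elim
      case (elim x)
      have "((\<lambda>x. integral {0..x} D) has_real_derivative D x) (at x within {0..x + 1})"
        using elim by (intro integral_has_real_derivative continuous_on_subset[OF cont]) auto
      then have "((\<lambda>x. integral {0..x} D) has_real_derivative D x) (at x within {0<..<x + 1})"
        by (rule DERIV_subset) auto
      then show ?case using elim by (subst (asm) at_within_open) auto
    qed
  qed (use lim in \<open>auto simp: filterlim_ident\<close>)
  from filterlim_compose[OF this filterlim_real_sequentially] show ?thesis .
qed

section \<open>Identification of the limit\<close>

text \<open>
  The covariation of \<open>B\<close> over \<open>[0, T]\<close> is the constant matrix \<open>T \<Sigma>\<close>, and the correction is half of it.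
\<close>

lemma iterated_stratonovich_of_ito:
  fixes B :: "real \<Rightarrow> 'w \<Rightarrow> real ^ 'd"
  assumes bm: "brownian_motion M B \<Sigma>" and "0 \<le> T" and I: "is_iterated_ito_integral M B T I"
  shows "is_iterated_stratonovich_integral M B T (\<lambda>\<omega>. I \<omega> + (T / 2) *\<^sub>R \<Sigma>)"
    and "is_iterated_stratonovich_integral M B T J \<Longrightarrow> AE \<omega> in M. J \<omega> = I \<omega> + (T / 2) *\<^sub>R \<Sigma>"
proof -
  note cov = brownian_motion_covariation[OF bm \<open>0 \<le> T\<close>]
  have ito: "is_ito_integral M (natural_filtration M B) (\<lambda>t \<omega>. B t \<omega> $ i) (\<lambda>t \<omega>. B t \<omega> $ j) T (\<lambda>\<omega>. I \<omega> $ i $ j)"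
    for i j
    using I unfolding is_iterated_ito_integral_def by blast
  show "is_iterated_stratonovich_integral M B T (\<lambda>\<omega>. I \<omega> + (T / 2) *\<^sub>R \<Sigma>)"
    unfolding is_iterated_stratonovich_integral_def is_stratonovich_integral_def
  proof (intro allI conjI exI)
    fix i j
    have [measurable]: "(\<lambda>\<omega>. I \<omega> $ i $ j) \<in> borel_measurable M"
      using ito[of i j] by (simp add: is_ito_integral_def)
    show "(\<lambda>\<omega>. (I \<omega> + (T / 2) *\<^sub>R \<Sigma>) $ i $ j) \<in> borel_measurable M" by simp
    show "AE \<omega> in M. (I \<omega> + (T / 2) *\<^sub>R \<Sigma>) $ i $ j = I \<omega> $ i $ j + T * \<Sigma> $ i $ j / 2" by simp
  qed (fact ito cov)+
  assume J: "is_iterated_stratonovich_integral M B T J"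
  have "AE \<omega> in M. J \<omega> $ i $ j = (I \<omega> + (T / 2) *\<^sub>R \<Sigma>) $ i $ j" for i j
  proof -
    from J obtain I' Q where
      I': "is_ito_integral M (natural_filtration M B) (\<lambda>t \<omega>. B t \<omega> $ i) (\<lambda>t \<omega>. B t \<omega> $ j) T I'"
      and Q: "is_covariation M (\<lambda>t \<omega>. B t \<omega> $ i) (\<lambda>t \<omega>. B t \<omega> $ j) T Q"
      and eq: "AE \<omega> in M. J \<omega> $ i $ j = I' \<omega> + Q \<omega> / 2"
      unfolding is_iterated_stratonovich_integral_def is_stratonovich_integral_def by blast
    have "AE \<omega> in M. Q \<omega> = T * \<Sigma> $ i $ j"
      by (rule is_covariation_unique[OF brownian_motionD(1)[OF bm] \<open>0 \<le> T\<close> _ _ Q cov])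
        (intro measurable_compose[OF brownian_motionD(2)[OF bm] borel_measurable_nth]; assumption)+
    with eq brownian_ito_integral_unique[OF bm I' ito] show ?thesis
      by eventually_elim simp
  qed
  then have "AE \<omega> in M. \<forall>i j. J \<omega> $ i $ j = (I \<omega> + (T / 2) *\<^sub>R \<Sigma>) $ i $ j"
    by (simp only: AE_all_countable simp_thms)
  then show "AE \<omega> in M. J \<omega> = I \<omega> + (T / 2) *\<^sub>R \<Sigma>"
    by eventually_elim (simp add: vec_eq_iff)
qed

theorem theorem3:
  fixes M :: "'v measure" and M' :: "'w measure"
    and \<Xi> :: "real \<Rightarrow> 'v \<Rightarrow> real ^ 'd"
    and B :: "real \<Rightarrow> 'w \<Rightarrow> real ^ 'd"
    and BB :: "real \<Rightarrow> 'w \<Rightarrow> real ^ 'd ^ 'd"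
    and \<Sigma> \<Gamma> :: "real ^ 'd ^ 'd"
  assumes "prob_space M"
    and "measurable_process M \<Xi>"
    and "stationary_process M \<Xi>"
    and "brownian_rough_path M' B BB \<Sigma> \<Gamma>"
    and "iterated_invariance_principle M (rescaled_integral \<Xi>) (rescaled_iterated_integral \<Xi>) M' B BB"
    and "\<forall>s\<ge>0. integrable M (\<lambda>\<omega>. \<Xi> 0 \<omega> \<otimes>\<^sub>t \<Xi> s \<omega>)"
    and "autocorrelation M \<Xi> integrable_on {0..}"
  shows "\<Sigma> = 2 *\<^sub>R sym_part (integral {0..} (autocorrelation M \<Xi>)) \<and>
    \<Gamma> = integral {0..} (autocorrelation M \<Xi>) \<and>
    (\<exists>J. is_iterated_stratonovich_integral M' B 1 J) \<and>
    (\<forall>J. is_iterated_stratonovich_integral M' B 1 J \<longrightarrow>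
       (AE \<omega> in M'. BB 1 \<omega> = J \<omega> + anti_part (integral {0..} (autocorrelation M \<Xi>))))"
proof -
  interpret \<Xi>: stationary_L2_process M \<Xi>
    using assms(1-3,6) by (simp add: stationary_L2_process_def stationary_L2_process_axioms_def)
  define A where "A = integral {0..} (autocorrelation M \<Xi>)"
  have bm: "brownian_motion M' B \<Sigma>" and ito: "is_iterated_ito_integral M' B 1 (\<lambda>\<omega>. BB 1 \<omega> - \<Gamma>)"
    using assms(4) by (auto simp: brownian_rough_path_def dest: spec[of _ 1])
  interpret M': prob_space M' by (rule brownian_motionD(1)[OF bm])
  note iip = assms(5)[unfolded iterated_invariance_principle_def]
  have int: "integrable M (\<lambda>\<omega>. rescaled_integral \<Xi> N 1 \<omega> \<otimes>\<^sub>t rescaled_integral \<Xi> N 1 \<omega>)"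
      "integrable M (rescaled_iterated_integral \<Xi> N 1)" if "N \<ge> 1" for N
    using iip that by blast+
  have int': "integrable M' (\<lambda>\<omega>. B 1 \<omega> \<otimes>\<^sub>t B 1 \<omega>)" "integrable M' (BB 1)"
    and lim: "(\<lambda>N. \<integral>\<omega>. rescaled_integral \<Xi> N 1 \<omega> \<otimes>\<^sub>t rescaled_integral \<Xi> N 1 \<omega> \<partial>M)
        \<longlonglongrightarrow> (\<integral>\<omega>. B 1 \<omega> \<otimes>\<^sub>t B 1 \<omega> \<partial>M')"
      "(\<lambda>N. \<integral>\<omega>. rescaled_iterated_integral \<Xi> N 1 \<omega> \<partial>M) \<longlonglongrightarrow> (\<integral>\<omega>. BB 1 \<omega> \<partial>M')"
    using iip by blast+
  note entry = integral_bounded_linear[OF bounded_linear_entry]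
    and entry_int = integrable_bounded_linear[OF bounded_linear_entry]
    and entry_lim = bounded_linear.tendsto[OF bounded_linear_entry]
  have mean_BB: "(\<integral>\<omega>. BB 1 \<omega> \<partial>M') $ i $ j = A $ i $ j" for i j
  proof -
    have "\<Xi>.corr i j integrable_on {0..}"
      and A: "integral {0..} (\<Xi>.corr i j) = A $ i $ j"
    proof -
      have "((\<lambda>s. autocorrelation M \<Xi> s $ i $ j) has_integral A $ i $ j) {0..}"
        using has_integral_linear[OF integrable_integral[OF assms(7)] bounded_linear_entry, of i j]
        by (simp add: o_def A_def)
      then have "(\<Xi>.corr i j has_integral A $ i $ j) {0..}"
        by (rule has_integral_eq[rotated]) (simp add: \<Xi>.autocorrelation_component)
      then show "\<Xi>.corr i j integrable_on {0..}" "integral {0..} (\<Xi>.corr i j) = A $ i $ j"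
        by (auto simp: integral_unique)
    qed
    have "continuous_on {0..} (\<lambda>u. integral {0..u} (\<Xi>.corr i j))"
      unfolding continuous_on_eq_continuous_within
    proof
      fix u :: real assume "u \<in> {0..}"
      have "continuous_on {0..u + 1} (\<lambda>u. integral {0..u} (\<Xi>.corr i j))"
        by (intro indefinite_integral_continuous_1 set_borel_integral_eq_integral(1) \<Xi>.set_integrable_corr)
      then have "continuous (at u within {0..u + 1}) (\<lambda>u. integral {0..u} (\<Xi>.corr i j))"
        using \<open>u \<in> {0..}\<close> by (auto simp: continuous_on_eq_continuous_within)
      moreover have "at u within {0..u + 1} = at u within {0..}"
        by (rule at_within_nhd[of u "{..<u + 1}"]) auto
      ultimately show "continuous (at u within {0..}) (\<lambda>u. integral {0..u} (\<Xi>.corr i j))" by simp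
    qed
    from cesaro_integral_tendsto[OF this integral_atLeast_tendsto[OF \<open>\<Xi>.corr i j integrable_on {0..}\<close>]]
    have "(\<lambda>N. integral {0..real N} (\<lambda>u. integral {0..u} (\<Xi>.corr i j)) / real N) \<longlonglongrightarrow> A $ i $ j"
      by (simp only: A)
    moreover have "\<forall>\<^sub>F N in sequentially. integral {0..real N} (\<lambda>u. integral {0..u} (\<Xi>.corr i j)) / real N
        = (\<integral>\<omega>. rescaled_iterated_integral \<Xi> N 1 \<omega> \<partial>M) $ i $ j"
      using eventually_ge_at_top[of 1]
      by eventually_elim (simp add: \<Xi>.expectation_rescaled_iterated_integral int(2))
    ultimately have "(\<lambda>N. (\<integral>\<omega>. rescaled_iterated_integral \<Xi> N 1 \<omega> \<partial>M) $ i $ j) \<longlonglongrightarrow> A $ i $ j"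
      by (rule Lim_transform_eventually)
    from LIMSEQ_unique[OF entry_lim[OF lim(2)] this] show ?thesis .
  qed
  have \<Gamma>: "\<Gamma> = A"
  proof -
    have "\<Gamma> $ i $ j = A $ i $ j" for i j
    proof -
      have "(\<integral>\<omega>. (BB 1 \<omega> - \<Gamma>) $ i $ j \<partial>M') = 0"
      proof (rule ito_integral_expectation[OF bm])
        show "is_ito_integral M' (natural_filtration M' B) (\<lambda>t \<omega>. B t \<omega> $ i) (\<lambda>t \<omega>. B t \<omega> $ j) 1
            (\<lambda>\<omega>. (BB 1 \<omega> - \<Gamma>) $ i $ j)"
          using ito unfolding is_iterated_ito_integral_def by blast
        show "integrable M' (\<lambda>\<omega>. (BB 1 \<omega> - \<Gamma>) $ i $ j)"
          using entry_int[OF int'(2), of i j] by simp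
      qed
      then show ?thesis
        using entry[OF int'(2), of i j] entry_int[OF int'(2), of i j] mean_BB[of i j]
        by (simp add: M'.prob_space)
    qed
    then show ?thesis by (simp add: vec_eq_iff)
  qed
  \<comment> \<open>Integration by parts for \<open>S_N\<close>, passed to the limit entry by entry.\<close>
  have \<Sigma>: "\<Sigma> = A + transpose A"
  proof -
    have "\<Sigma> $ i $ j = A $ i $ j + A $ j $ i" for i j
    proof -
      have "(\<integral>\<omega>. B 1 \<omega> \<otimes>\<^sub>t B 1 \<omega> \<partial>M') $ i $ j = (\<integral>\<omega>. B 1 \<omega> $ i * B 1 \<omega> $ j \<partial>M')"
        using entry[OF int'(1), of i j] by (simp add: tensor_def)
      also have "\<dots> = (\<integral>\<omega>. (B 1 \<omega> - B 0 \<omega>) $ i * (B 1 \<omega> - B 0 \<omega>) $ j \<partial>M')"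
      proof (rule integral_cong_AE)
        show "AE \<omega> in M'. B 1 \<omega> $ i * B 1 \<omega> $ j = (B 1 \<omega> - B 0 \<omega>) $ i * (B 1 \<omega> - B 0 \<omega>) $ j"
          using brownian_motionD(3)[OF bm] by eventually_elim simp
        show "(\<lambda>\<omega>. B 1 \<omega> $ i * B 1 \<omega> $ j) \<in> borel_measurable M'"
          using entry_int[OF int'(1), of i j] by (simp add: tensor_def borel_measurable_integrable)
        show "(\<lambda>\<omega>. (B 1 \<omega> - B 0 \<omega>) $ i * (B 1 \<omega> - B 0 \<omega>) $ j) \<in> borel_measurable M'"
          using brownian_increment_moments(3)[OF bm, of 0 1 i j] by (intro borel_measurable_integrable) simp
      qed
      also have "\<dots> = \<Sigma> $ i $ j"
        using brownian_increment_moments(4)[OF bm, of 0 1 i j] by simp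
      finally have cov: "(\<integral>\<omega>. B 1 \<omega> \<otimes>\<^sub>t B 1 \<omega> \<partial>M') $ i $ j = \<Sigma> $ i $ j" .
      have "\<forall>\<^sub>F N in sequentially.
          (\<integral>\<omega>. rescaled_iterated_integral \<Xi> N 1 \<omega> \<partial>M) $ i $ j
          + (\<integral>\<omega>. rescaled_iterated_integral \<Xi> N 1 \<omega> \<partial>M) $ j $ i
        = (\<integral>\<omega>. rescaled_integral \<Xi> N 1 \<omega> \<otimes>\<^sub>t rescaled_integral \<Xi> N 1 \<omega> \<partial>M) $ i $ j"
        using eventually_ge_at_top[of 1]
      proof eventually_elim
        case (elim N)
        have "(\<integral>\<omega>. rescaled_iterated_integral \<Xi> N 1 \<omega> $ i $ j + rescaled_iterated_integral \<Xi> N 1 \<omega> $ j $ i \<partial>M)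
          = (\<integral>\<omega>. (rescaled_integral \<Xi> N 1 \<omega> \<otimes>\<^sub>t rescaled_integral \<Xi> N 1 \<omega>) $ i $ j \<partial>M)"
        proof (rule integral_cong_AE)
          show "AE \<omega> in M. rescaled_iterated_integral \<Xi> N 1 \<omega> $ i $ j + rescaled_iterated_integral \<Xi> N 1 \<omega> $ j $ i
              = (rescaled_integral \<Xi> N 1 \<omega> \<otimes>\<^sub>t rescaled_integral \<Xi> N 1 \<omega>) $ i $ j"
            using \<Xi>.AE_rescaled_iterated_integral[OF elim]
          proof eventually_elim
            case (elim \<omega>)
            then have "rescaled_integral \<Xi> N 1 \<omega> $ i * rescaled_integral \<Xi> N 1 \<omega> $ j
              = rescaled_iterated_integral \<Xi> N 1 \<omega> $ i $ j + rescaled_iterated_integral \<Xi> N 1 \<omega> $ j $ i"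
              by blast
            then show ?case by (simp add: tensor_def)
          qed
        qed (intro borel_measurable_add borel_measurable_integrable entry_int int elim)+
        then show ?case
          using entry[OF int(1)[OF elim], of i j] entry[OF int(2)[OF elim]] entry_int[OF int(2)[OF elim]]
          by simp
      qed
      from Lim_transform_eventually[OF tendsto_add[OF entry_lim[OF lim(2)] entry_lim[OF lim(2)]] this]
      have "(\<lambda>N. (\<integral>\<omega>. rescaled_integral \<Xi> N 1 \<omega> \<otimes>\<^sub>t rescaled_integral \<Xi> N 1 \<omega> \<partial>M) $ i $ j)
        \<longlonglongrightarrow> A $ i $ j + A $ j $ i"
        by (simp only: mean_BB)
      from LIMSEQ_unique[OF entry_lim[OF lim(1)] this] show ?thesis by (simp only: cov)
    qed
    then show ?thesis by (simp add: vec_eq_iff transpose_def)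
  qed
  \<comment> \<open>\<open>\<Sigma> / 2\<close> is the symmetric part of \<open>A\<close>, so what remains of \<open>\<Gamma> = A\<close> is its antisymmetric part.\<close>
  have corr: "BB 1 \<omega> = (BB 1 \<omega> - \<Gamma>) + (1 / 2) *\<^sub>R \<Sigma> + anti_part A" for \<omega>
    unfolding \<Gamma> \<Sigma> anti_part_def by (simp add: scaleR_add_right scaleR_diff_right flip: scaleR_add_left)
  note strat = iterated_stratonovich_of_ito[OF bm zero_le_one ito]
  have "\<Sigma> = 2 *\<^sub>R sym_part A" by (simp add: \<Sigma> sym_part_def)
  moreover have "AE \<omega> in M'. BB 1 \<omega> = J \<omega> + anti_part A" if "is_iterated_stratonovich_integral M' B 1 J" for J
    using strat(2)[OF that] by eventually_elim (use corr in simp)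
  ultimately show ?thesis
    using \<Gamma> strat(1) unfolding A_def[symmetric] by blast
qed

end
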